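(* Let $k\ge 4$ be an integer, let $a, N$ be integers with $N>0$, and let $\eta_3>0$ and $h>1$ be real numbers. Let $f$ be a real-valued function with $k$ continuous derivatives, with $f^{(k)}$ monotonic, and suppose that $0<\lambda_k \le |f^{(k)}(x)| \le h\lambda_k$ for all $x\in(a,a+N]$. Then, with $K = 2^{k-1}$, $$S_f(a,N) \le A_k(\eta_3,h)\, h^{2/K} N \lambda_k^{1/(2K-2)} + B_k(\eta_3)\, N^{1-2/K}\lambda_k^{-1/(2K-2)},$$ where the $A_k, B_k$ for $k\ge 4$ are defined recursively, for $j\ge 3$ and $J := 2^{j-1}$, by $$A_{j+1}(\eta_3,h) := \delta_j\left(h^{-1/J} + \frac{2^{19/12}(J-1)}{\sqrt{(2J-1)(4J-3)}}\,A_j(\eta_3,h)^{1/2}\right),\qquad B_{j+1}(\eta_3) := \delta_j\,\frac{2^{3/2}(J-1)}{\sqrt{(2J-3)(4J-5)}}\,B_j(\eta_3)^{1/2},$$ $$\delta_j := \sqrt{1+\frac{2}{2337^{1-2/J}}\left(\frac{9\pi}{1024}\eta_3\right)^{1/J}},$$ with initial values $A_3(\eta_3,h)$, $B_3(\eta_3)$ given in the context.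
   Context: Notation: $e(x) := \exp(2\pi i x)$ and $S_f(a,N) := \left|\sum_{a<n\le a+N} e(f(n))\right|$, the sum being over integers $n$. Initial values: for $\eta_3>0$, $h>1$, $$A_3(\eta_3,h) := \tilde\delta\,\sqrt{\frac{1}{\eta_3 h} + \frac{32}{15\sqrt{\pi}}\sqrt{\eta_3+\lambda_0^{1/3}} + \frac13\left(\eta_3+\lambda_0^{1/3}\right)\lambda_0^{1/3}},\qquad B_3(\eta_3) := \frac{\sqrt{32}}{\sqrt3\,\pi^{1/4}\eta_3^{1/4}}\,\tilde\delta,$$ $$\lambda_0 := \left(\frac1{\eta_3}+\frac{32\,\eta_3^{1/2}h}{15\sqrt\pi}\right)^{-3},\qquad \tilde\delta := \sqrt{\frac12+\frac12\sqrt{1+\frac38\pi^{1/2}\eta_3^{3/2}}}.$$ (The quantity $\tilde\delta$ is not the same as $\delta_3$, the $j=3$ case of $\delta_j$ in the claim.) *)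

theory Defs
  imports Complex_Main
begin

definition e_fun :: "real \<Rightarrow> complex" where
  "e_fun x = exp (2 * of_real pi * \<i> * of_real x)"

definition S_sum :: "(real \<Rightarrow> real) \<Rightarrow> int \<Rightarrow> int \<Rightarrow> real" where
  "S_sum f a N = norm (\<Sum>n\<in>{a<..a + N}. e_fun (f (of_int n)))"

(* f is k times continuously differentiable on I with i-th derivative D i for i <= k.
   Derivatives are taken within I, hence one-sided at an endpoint belonging to I; on a
   nondegenerate interval I they are unique, so f determines D 0, ..., D k on I. *)
definition Ck_with_derivs_on ::
  "nat \<Rightarrow> (real \<Rightarrow> real) \<Rightarrow> (nat \<Rightarrow> real \<Rightarrow> real) \<Rightarrow> real set \<Rightarrow> bool" where
  "Ck_with_derivs_on k f D I \<longleftrightarrow>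
     (\<forall>x\<in>I. D 0 x = f x) \<and>
     (\<forall>i<k. \<forall>x\<in>I. (D i has_real_derivative D (Suc i) x) (at x within I)) \<and>
     continuous_on I (D k)"

definition lambda0 :: "real \<Rightarrow> real \<Rightarrow> real" where
  "lambda0 \<eta> h = (1 / \<eta> + 32 * \<eta> powr (1/2) * h / (15 * sqrt pi)) powr (- 3)"

definition delta_tilde :: "real \<Rightarrow> real" where
  "delta_tilde \<eta> = sqrt (1/2 + 1/2 * sqrt (1 + 3/8 * pi powr (1/2) * \<eta> powr (3/2)))"

definition A3 :: "real \<Rightarrow> real \<Rightarrow> real" where
  "A3 \<eta> h = delta_tilde \<eta> *
     sqrt (1 / (\<eta> * h)
           + 32 / (15 * sqrt pi) * sqrt (\<eta> + lambda0 \<eta> h powr (1/3))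
           + 1/3 * (\<eta> + lambda0 \<eta> h powr (1/3)) * lambda0 \<eta> h powr (1/3))"

definition B3 :: "real \<Rightarrow> real" where
  "B3 \<eta> = sqrt 32 / (sqrt 3 * pi powr (1/4) * \<eta> powr (1/4)) * delta_tilde \<eta>"

definition delta :: "nat \<Rightarrow> real \<Rightarrow> real" where
  "delta j \<eta> = (let J = 2 ^ (j - 1) in
     sqrt (1 + 2 / 2337 powr (1 - 2 / J) * (9 * pi / 1024 * \<eta>) powr (1 / J)))"

(* A_coeff j and B_coeff j are meaningful only for j >= 3; the values at j < 3 are junk. *)
primrec A_coeff :: "nat \<Rightarrow> real \<Rightarrow> real \<Rightarrow> real" where
  "A_coeff 0 \<eta> h = A3 \<eta> h"
| "A_coeff (Suc j) \<eta> h =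
     (if j < 3 then A3 \<eta> h
      else let J = 2 ^ (j - 1) in
        delta j \<eta> *
          (h powr (- 1 / J)
           + 2 powr (19/12) * (J - 1) / sqrt ((2 * J - 1) * (4 * J - 3)) * A_coeff j \<eta> h powr (1/2)))"

primrec B_coeff :: "nat \<Rightarrow> real \<Rightarrow> real" where
  "B_coeff 0 \<eta> = B3 \<eta>"
| "B_coeff (Suc j) \<eta> =
     (if j < 3 then B3 \<eta>
      else let J = 2 ^ (j - 1) in
        delta j \<eta> *
          (2 powr (3/2) * (J - 1) / sqrt ((2 * J - 3) * (4 * J - 5))) * B_coeff j \<eta> powr (1/2))"

end

theory Submission
  imports Defs "HOL-Analysis.Analysis"
begin

text \<open>Only the forward differences of the sequence $f(n)$ matter: by the mean value theorem the $k$-th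
difference is a value of $f^{(k)}$, which has constant sign, so up to conjugation it lies in
$[\lambda_k, h\lambda_k]$; and the shift difference $x_{n+m} - x_n$ has $(k-1)$-st differences in
$[m\lambda_k, hm\lambda_k]$. For second differences the sum is split according to the distance of
$x_{n+1} - x_n$ to the nearest integer, with the Kuzmin-Landau inequality away from the integers and the
trivial bound near them. Each further difference costs one Weyl-van der Corput step, whose
shift length $M$ is about $\eta_3\lambda_3^{-1/3}$ for $k = 3$ and $\lambda_{j+1}^{-1/(2J-1)}$ for the
step from $j$ to $j+1$. The factors $\tilde\delta$ and $\delta_j$ absorb $(N + M - 1)/N$, because
the claim is trivial unless its right-hand side is smaller than $N$.\<close>

subsection \<open>The Kuzmin-Landau inequality\<close>


text \<open>All constants are explicit, so every loss must fit a prescribed factor. The main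
  obstacle is (N + M - 1)/N: the shift length M depends on lambda, not on N. In the nontrivial case
  the B-term is below N, and this bounds M/N through B. For k = 3 that B already contains the factor
  being sought, so the square of \<open>delta_tilde\<close> solves a quadratic equation; hence the
  nested root. For the step from j to j+1 an upper bound for 1/B_j in terms of \<open>\<eta>\<close>
  alone is needed; it is carried along the recursion, and 9 pi/1024 comes from its initial case. The
  other constants come from integrals: the integral of (1 - t) t^alpha over [0, 1] is 1/((1 +
  alpha)(2 + alpha)). With alpha = 1/2 and -1/2 it gives 4/15 and 4/3, hence 32/15 = 2 * 4 * 4/15
  and 32/3 = 2 * 4 * 4/3, where 2 comes from Weyl-van der Corput and 4 from the second difference
  test. With alpha = 1/(2J - 2) and its negative it gives the fractions in J. In 2^(19/12) = 2^(3/2)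
  2^(1/12) the last factor pays for rounding M to an integer.\<close>

lemma e_fun_eq_cis: "e_fun x = cis (2 * pi * x)"
  unfolding e_fun_def cis_conv_exp by (simp add: algebra_simps)

lemma norm_e_fun [simp]: "norm (e_fun x) = 1"
  by (simp add: e_fun_eq_cis)

lemma e_fun_add: "e_fun (x + y) = e_fun x * e_fun y"
  by (simp add: e_fun_eq_cis cis_mult algebra_simps)

lemma cnj_e_fun: "cnj (e_fun x) = e_fun (- x)"
  by (simp add: e_fun_eq_cis cis_cnj)

lemma e_fun_diff: "e_fun (x - y) = e_fun x * cnj (e_fun y)"
  using e_fun_add[of x "- y"] by (simp add: cnj_e_fun)

lemma e_fun_of_int [simp]: "e_fun (of_int n) = 1"
  using cis_multiple_2pi[of "of_int n"] by (simp add: e_fun_eq_cis)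

text \<open>This is 1/(e(t) - 1) in Cartesian form. The real part is constant, so the difference of
  two weights is purely imaginary and its norm is half a difference of cotangents.\<close>

definition kl_weight :: "real \<Rightarrow> complex" where
  "kl_weight t = Complex (- 1 / 2) (- cot (pi * t) / 2)"

lemma kl_weight_mult:
  assumes "0 < t" "t < 1"
  shows "kl_weight t * (e_fun t - 1) = 1"
proof -
  have s: "sin (pi * t) > 0"
    using assms by (intro sin_gt_zero) auto
  have "cos (2 * (pi * t)) = 1 - 2 * (sin (pi * t))\<^sup>2"
    by (simp add: cos_double_sin)
  moreover have "sin (2 * (pi * t)) = 2 * sin (pi * t) * cos (pi * t)"
    by (simp add: sin_double)
  ultimately have *: "e_fun t - 1 = Complex (- 2 * (sin (pi * t))\<^sup>2) (2 * sin (pi * t) * cos (pi * t))"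
    by (simp add: e_fun_eq_cis complex_eq_iff mult.assoc)
  have "(sin (pi * t))\<^sup>2 + (cos (pi * t))\<^sup>2 = 1" by simp
  then show ?thesis
    unfolding * using s
    by (simp add: kl_weight_def complex_eq_iff cot_def power2_eq_square)
qed

lemma norm_kl_weight:
  assumes "0 < t" "t < 1"
  shows "norm (kl_weight t) = 1 / (2 * sin (pi * t))"
proof -
  have s: "sin (pi * t) > 0"
    using assms by (intro sin_gt_zero) auto
  have "(norm (kl_weight t))\<^sup>2 = (1 / (2 * sin (pi * t)))\<^sup>2"
    using s sin_cos_squared_add[of "pi * t"]
    unfolding kl_weight_def cmod_power2 by (simp add: cot_def field_simps power2_eq_square)
  then show ?thesis using s by simp
qed

lemma cot_mono:
  assumes "0 < s" "s \<le> t" "t < pi"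
  shows "cot t \<le> cot s"
proof -
  have "sin s > 0" "sin t > 0" "sin (t - s) \<ge> 0"
    using assms by (auto intro!: sin_gt_zero sin_ge_zero)
  then show ?thesis by (simp add: cot_def sin_diff field_simps)
qed

text \<open>The left side is cot(t/2), and tan b >= b for b = t/2; the latter is used as b cos b <=
  sin b, because sin t - t cos t has derivative t sin t.\<close>

lemma csc_plus_cot_le:
  assumes "0 < t" "t < pi"
  shows "1 / sin t + cot t \<le> 2 / t"
proof -
  define b where "b = t / 2"
  have b: "0 < b" "b < pi / 2" "t = 2 * b" using assms by (auto simp: b_def)
  have c: "cos b > 0" using b by (intro cos_gt_zero) auto
  have s: "sin b > 0" using b by (intro sin_gt_zero) auto
  have "\<exists>d. ((\<lambda>t. sin t - t * cos t) has_real_derivative d) (at y) \<and> 0 \<le> d"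
    if y: "0 \<le> y" "y \<le> b" for y
  proof -
    have "((\<lambda>t. sin t - t * cos t) has_real_derivative y * sin y) (at y)"
      by (auto intro!: derivative_eq_intros)
    moreover have "0 \<le> y * sin y"
      using y b by (intro mult_nonneg_nonneg sin_ge_zero) auto
    ultimately show ?thesis by blast
  qed
  then have "(\<lambda>t. sin t - t * cos t) 0 \<le> (\<lambda>t. sin t - t * cos t) b"
    using b(1) by (intro DERIV_nonneg_imp_nondecreasing[of 0 b "\<lambda>t. sin t - t * cos t"]) auto
  then have *: "b * cos b \<le> sin b" by simp
  have "1 / sin t + cot t = (1 + cos t) / sin t"
    by (simp add: cot_def add_divide_distrib)
  also have "\<dots> = cos b / sin b"
  proof -
    have "sin t = 2 * sin b * cos b" "1 + cos t = 2 * cos b * cos b"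
      by (simp_all add: b(3) sin_double cos_double_cos power2_eq_square)
    then show ?thesis using s c by simp
  qed
  also have "\<dots> \<le> 1 / b" using * s b by (simp add: field_simps)
  finally show ?thesis by (simp add: b(3))
qed

lemma csc_minus_cot_le:
  assumes "0 < t" "t < pi"
  shows "1 / sin t - cot t \<le> 2 / (pi - t)"
  using csc_plus_cot_le[of "pi - t"] assms by (simp add: cot_def)

text \<open>With the weights $c_n = 1/(e(\theta_n) - 1)$ each term is $c_n$ times the increment of $e(x_n)$;
monotonicity makes the total variation of the weights telescope, so the two ends contribute
separately. Bounding both ends by the smaller of the two distances would be too lossy later.\<close>

lemma kuzmin_landau:
  fixes x :: "nat \<Rightarrow> real" and \<nu> :: int and l r :: real
  assumes l: "0 < l" and r: "r < 1"
    and range: "\<And>n. u \<le> n \<Longrightarrow> n < v \<Longrightarrow> \<nu> + l \<le> x (Suc n) - x n \<and> x (Suc n) - x n \<le> \<nu> + r"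
    and mono: "\<And>n. u \<le> n \<Longrightarrow> Suc n < v \<Longrightarrow> x (Suc n) - x n \<le> x (Suc (Suc n)) - x (Suc n)"
  shows "norm (\<Sum>n\<in>{u..<v}. e_fun (x n)) \<le> 1 / (pi * l) + 1 / (pi * (1 - r))"
proof (cases "u < v")
  case False
  then show ?thesis using l r by simp
next
  case True
  define t where "t n = x (Suc n) - x n - \<nu>" for n
  define c where "c n = kl_weight (t n)" for n
  have t01: "0 < t n \<and> t n < 1 \<and> l \<le> t n \<and> t n \<le> r" if "u \<le> n" "n < v" for n
    using range[OF that] l r by (auto simp: t_def)
  have step: "e_fun (x n) = c n * (e_fun (x (Suc n)) - e_fun (x n))" if "u \<le> n" "n < v" for n
  proof -
    have "e_fun (x (Suc n)) = e_fun (x n + t n + of_int \<nu>)" by (simp add: t_def)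
    also have "\<dots> = e_fun (x n) * e_fun (t n)" by (simp only: e_fun_add e_fun_of_int mult_1_right)
    finally have "c n * (e_fun (x (Suc n)) - e_fun (x n)) = e_fun (x n) * (c n * (e_fun (t n) - 1))"
      by (simp add: algebra_simps)
    then show ?thesis using kl_weight_mult[of "t n"] t01[OF that] by (simp add: c_def)
  qed
  \<comment> \<open>Summation by parts as an induction on the upper end: with the boundary term at w
    removed, each new index costs only the change of the weight, and these changes
    telescope.\<close>
  have "norm ((\<Sum>n\<in>{u..w}. e_fun (x n)) - c w * e_fun (x (Suc w)))
      \<le> norm (c u) + (cot (pi * t u) - cot (pi * t w)) / 2" if "u \<le> w" "w < v" for w
    using that
  proof (induction w rule: dec_induct)
    case base
    have "e_fun (x u) - c u * e_fun (x (Suc u)) = - (c u * e_fun (x u))"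
      using step[of u] True by (simp add: algebra_simps)
    then have "norm (e_fun (x u) - c u * e_fun (x (Suc u))) = norm (c u)"
      by (simp add: norm_mult)
    then show ?case by simp
  next
    case (step w)
    have "cot (pi * t (Suc w)) \<le> cot (pi * t w)"
      using t01[of w] t01[of "Suc w"] mono[of w] step.hyps step.prems
      by (intro cot_mono) (auto simp: t_def)
    then have d: "norm (c w - c (Suc w)) = (cot (pi * t w) - cot (pi * t (Suc w))) / 2"
      by (simp add: c_def kl_weight_def cmod_def)
    have eq: "(\<Sum>n\<in>{u..Suc w}. e_fun (x n)) - c (Suc w) * e_fun (x (Suc (Suc w)))
        = ((\<Sum>n\<in>{u..w}. e_fun (x n)) - c w * e_fun (x (Suc w))) + (c w - c (Suc w)) * e_fun (x (Suc w))"
      using \<open>\<And>n. u \<le> n \<Longrightarrow> n < v \<Longrightarrow> e_fun (x n) = c n * (e_fun (x (Suc n)) - e_fun (x n))\<close>[of "Suc w"]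
        step.hyps step.prems by (simp add: algebra_simps)
    show ?case
      unfolding eq using step.IH step.prems d
      by (intro norm_triangle_le) (simp add: norm_mult diff_divide_distrib)
  qed
  from this[of "v - 1"] True
  have *: "norm ((\<Sum>n\<in>{u..<v}. e_fun (x n)) - c (v - 1) * e_fun (x v))
      \<le> norm (c u) + (cot (pi * t u) - cot (pi * t (v - 1))) / 2"
    by (cases v) (auto simp: atLeastLessThanSuc_atLeastAtMost)
  have "norm (\<Sum>n\<in>{u..<v}. e_fun (x n))
      \<le> norm ((\<Sum>n\<in>{u..<v}. e_fun (x n)) - c (v - 1) * e_fun (x v)) + norm (c (v - 1) * e_fun (x v))"
    using norm_triangle_ineq[of "(\<Sum>n\<in>{u..<v}. e_fun (x n)) - c (v - 1) * e_fun (x v)" "c (v - 1) * e_fun (x v)"]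
    by simp
  also have "\<dots> \<le> norm (c u) + (cot (pi * t u) - cot (pi * t (v - 1))) / 2 + norm (c (v - 1))"
    using * by (simp add: norm_mult)
  \<comment> \<open>Each boundary weight has norm 1/(2 sin), which pairs with the telescoped
    cotangent at the same end.\<close>
  also have "\<dots> = (1 / sin (pi * t u) + cot (pi * t u)) / 2
      + (1 / sin (pi * t (v - 1)) - cot (pi * t (v - 1))) / 2"
    using t01[of u] t01[of "v - 1"] True by (simp add: c_def norm_kl_weight field_simps)
  also have "\<dots> \<le> (2 / (pi * t u)) / 2 + (2 / (pi - pi * t (v - 1))) / 2"
    using t01[of u] t01[of "v - 1"] True
    by (intro add_mono divide_right_mono csc_plus_cot_le csc_minus_cot_le) auto
  also have "\<dots> = 1 / (pi * t u) + 1 / (pi * (1 - t (v - 1)))"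
  proof -
    have "2 / z / 2 = 1 / z" for z :: real by simp
    then show ?thesis by (simp only: right_diff_distrib mult_1_right)
  qed
  also have "\<dots> \<le> 1 / (pi * l) + 1 / (pi * (1 - r))"
    using t01[of u] t01[of "v - 1"] True l r
    by (intro add_mono frac_le) auto
  finally show ?thesis .
qed


subsection \<open>Second differences\<close>

lemma norm_sum_e_fun_le_card: "norm (\<Sum>n\<in>X. e_fun (x n)) \<le> real (card X)"
  using norm_sum[of "\<lambda>n. e_fun (x n)" X] by simp

lemma spaced_diff_ge:
  fixes \<theta> :: "nat \<Rightarrow> real"
  assumes "\<And>n. Suc n < N \<Longrightarrow> \<theta> n + lam \<le> \<theta> (Suc n)" and "i \<le> j" "j < N"
  shows "\<theta> i + real (j - i) * lam \<le> \<theta> j"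
  using assms(2,3)
proof (induction j rule: dec_induct)
  case (step j)
  then show ?case using assms(1)[of j] by (simp add: Suc_diff_le algebra_simps)
qed simp

lemma card_spaced_le:
  fixes \<theta> :: "nat \<Rightarrow> real"
  assumes sp: "\<And>n. Suc n < N \<Longrightarrow> \<theta> n + lam \<le> \<theta> (Suc n)" and "0 < lam" and "l \<le> r"
    and X: "X \<subseteq> {..<N}" "\<And>n. n \<in> X \<Longrightarrow> l \<le> \<theta> n \<and> \<theta> n \<le> r"
  shows "real (card X) \<le> (r - l) / lam + 1"
proof (cases "X = {}")
  case True
  then show ?thesis using assms by simp
next
  case False
  have fin: "finite X" using X(1) finite_subset by blast
  define i j where "i = Min X" and "j = Max X"
  have ij: "i \<in> X" "j \<in> X" "i \<le> j" using fin False by (auto simp: i_def j_def)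
  have "X \<subseteq> {i..j}" using fin by (auto simp: i_def j_def)
  then have "card X \<le> j - i + 1" using ij card_mono[of "{i..j}" X] by simp
  moreover have "real (j - i) * lam \<le> r - l"
  proof -
    have "\<theta> i + real (j - i) * lam \<le> \<theta> j"
      by (rule spaced_diff_ge[of N \<theta> lam]) (use sp ij X in auto)
    moreover have "l \<le> \<theta> i" "\<theta> j \<le> r" using X(2) ij by auto
    ultimately show ?thesis by linarith
  qed
  then have "real (j - i) \<le> (r - l) / lam" using \<open>0 < lam\<close> by (simp add: field_simps)
  ultimately show ?thesis by linarith
qed

text \<open>The pieces used below are preimages of intervals under a monotone sequence. For these,
  convexity of the index set is easier to check than explicit end points, which are recovered as
  minimum and maximum.\<close>

lemma kuzmin_landau_convex:
  fixes x :: "nat \<Rightarrow> real" and \<nu> :: int and l r :: real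
  assumes l: "0 < l" and r: "r < 1"
    and X: "X \<subseteq> {..<N}" "\<And>i n j. i \<in> X \<Longrightarrow> j \<in> X \<Longrightarrow> i \<le> n \<Longrightarrow> n \<le> j \<Longrightarrow> n \<in> X"
    and range: "\<And>n. n \<in> X \<Longrightarrow> \<nu> + l \<le> x (Suc n) - x n \<and> x (Suc n) - x n \<le> \<nu> + r"
    and mono: "\<And>n. Suc n < N \<Longrightarrow> x (Suc n) - x n \<le> x (Suc (Suc n)) - x (Suc n)"
  shows "norm (\<Sum>n\<in>X. e_fun (x n)) \<le> 1 / (pi * l) + 1 / (pi * (1 - r))"
proof (cases "X = {}")
  case True
  then show ?thesis using l r by simp
next
  case False
  have fin: "finite X" using X(1) finite_subset by blast
  define i j where "i = Min X" and "j = Max X"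
  have ij: "i \<in> X" "j \<in> X" using fin False by (auto simp: i_def j_def)
  have eq: "X = {i..<Suc j}" using fin X(2)[OF ij] by (auto simp: i_def j_def less_Suc_eq_le)
  have "j < N" using ij X(1) by auto
  show ?thesis
    unfolding eq
  proof (rule kuzmin_landau[OF l r])
    show "\<nu> + l \<le> x (Suc n) - x n \<and> x (Suc n) - x n \<le> \<nu> + r" if "i \<le> n" "n < Suc j" for n
      by (rule range) (use that in \<open>simp add: eq\<close>)
    show "x (Suc n) - x n \<le> x (Suc (Suc n)) - x (Suc n)" if "i \<le> n" "Suc n < Suc j" for n
      by (rule mono) (use that \<open>j < N\<close> in simp)
  qed
qed

text \<open>The proof groups the indices by the integer part of $y_n = \theta_n + d$. A block consists of a piece
near an integer, with at most $2d/\lambda + 1$ terms, followed by a piece away from the integers. The choice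
$d = \sqrt{\lambda/\pi}$ balances the two costs, so that a complete block costs at most $4D + 1$, where
$D = 1/(\pi d) = d/\lambda$; the incomplete first and last blocks together cost no more than their
share in proportion to the range of $\theta$, up to one complete block and the additive constant 1.\<close>

lemma spaced_e_sum_bound:
  fixes x \<theta> :: "nat \<Rightarrow> real" and lam :: real
  defines "\<theta> \<equiv> \<lambda>n. x (Suc n) - x n"
  assumes N: "0 < N" and sp: "\<And>n. Suc n < N \<Longrightarrow> \<theta> n + lam \<le> \<theta> (Suc n)"
    and lam: "0 < lam" "lam < pi / 16"
  shows "norm (\<Sum>n<N. e_fun (x n)) \<le> (\<theta> (N - 1) - \<theta> 0 + 1) * (4 / sqrt (pi * lam) + 1) + 1"
proof -
  define d where "d = sqrt (lam / pi)"
  define D where "D = 1 / (pi * d)"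
  have d0: "0 < d" using lam by (simp add: d_def)
  have dd: "d * d = lam / pi" using lam by (simp add: d_def)
  \<comment> \<open>\<open>d < 1 / 4\<close> is what later makes the saving p D/d in a cut first
    block at least 4 p D.\<close>
  have "d < sqrt ((1/4)\<^sup>2)"
    unfolding d_def using lam by (intro real_sqrt_less_mono) (simp add: field_simps power2_eq_square)
  then have d4: "d < 1 / 4" by (simp add: real_sqrt_abs)
  have D0: "0 < D" using d0 by (simp add: D_def)
  have lam_def: "lam = pi * d * d" using dd by (simp add: field_simps)
  have dl: "t / lam = t * D / d" for t
    using d0 by (simp add: D_def lam_def)
  have "sqrt (pi * lam) = pi * d"
    using d0 by (intro real_sqrt_unique) (simp_all add: lam_def power2_eq_square)
  then have D_eq: "4 / sqrt (pi * lam) = 4 * D" by (simp add: D_def)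
  have mono: "\<theta> i \<le> \<theta> j" if "i \<le> j" "j < N" for i j
  proof -
    have "\<theta> i + real (j - i) * lam \<le> \<theta> j" by (rule spaced_diff_ge[of N \<theta> lam]) (use sp that in auto)
    moreover have "0 \<le> real (j - i) * lam" using lam by simp
    ultimately show ?thesis by linarith
  qed
  \<comment> \<open>The shift by d puts a whole neighbourhood [k - d, k + d) of the integer k into
    the block \<open>A k\<close>: the near piece is y - k < 2d, and on the rest
    \<open>\<theta>\<close> stays at distance at least d from the integers.\<close>
  define y where "y n = \<theta> n + d" for n
  define A where "A k = {n. n < N \<and> \<lfloor>y n\<rfloor> = k}" for k
  have A_iff: "n \<in> A k \<longleftrightarrow> n < N \<and> of_int k \<le> y n \<and> y n < of_int k + 1" for n k
    by (auto simp: A_def floor_eq_iff)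
  have block: "norm (\<Sum>n\<in>A k. e_fun (x n)) \<le> a + b"
    if a: "norm (\<Sum>n\<in>{n\<in>A k. y n < k + 2 * d}. e_fun (x n)) \<le> a"
      and b: "norm (\<Sum>n\<in>{n\<in>A k. \<not> y n < k + 2 * d}. e_fun (x n)) \<le> b" for k :: int and a b
  proof -
    have fin: "finite (A k)" by (auto simp: A_def)
    have "(\<Sum>n\<in>A k. e_fun (x n)) = (\<Sum>n\<in>{n\<in>A k. y n < k + 2 * d}. e_fun (x n))
        + (\<Sum>n\<in>{n\<in>A k. \<not> y n < k + 2 * d}. e_fun (x n))"
      using fin by (subst sum.union_disjoint[symmetric]) (auto intro!: sum.cong)
    then show ?thesis using norm_triangle_mono[OF a b] by simp
  qed
  have near: "norm (\<Sum>n\<in>{n\<in>A k. y n < k + 2 * d}. e_fun (x n)) \<le> (s - p) / lam + 1"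
    if "p \<le> s" "\<And>n. n \<in> A k \<Longrightarrow> y n < k + 2 * d \<Longrightarrow> p \<le> y n - k \<and> y n - k \<le> s" for k :: int and p s
  proof -
    have "real (card {n\<in>A k. y n < k + 2 * d}) \<le> ((k + s - d) - (k + p - d)) / lam + 1"
    proof (rule card_spaced_le[of N \<theta>, OF _ lam(1)])
      fix n assume n: "n \<in> {n\<in>A k. y n < k + 2 * d}"
      then show "k + p - d \<le> \<theta> n \<and> \<theta> n \<le> k + s - d"
        using that(2)[of n] by (simp add: y_def)
    qed (use that(1) sp in \<open>auto simp: A_def\<close>)
    then show ?thesis
      using norm_sum_e_fun_le_card[of x "{n\<in>A k. y n < k + 2 * d}"] by simp
  qed
  have far: "norm (\<Sum>n\<in>{n\<in>A k. \<not> y n < k + 2 * d}. e_fun (x n)) \<le> 1 / (pi * (p - d)) + 1 / (pi * (1 - s + d))"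
    if "d < p" "s < 1 + d" "\<And>n. n \<in> A k \<Longrightarrow> \<not> y n < k + 2 * d \<Longrightarrow> p \<le> y n - k \<and> y n - k \<le> s" for k :: int and p s
  proof -
    have "norm (\<Sum>n\<in>{n\<in>A k. \<not> y n < k + 2 * d}. e_fun (x n)) \<le> 1 / (pi * (p - d)) + 1 / (pi * (1 - (s - d)))"
    proof (rule kuzmin_landau_convex[where N = N and \<nu> = k])
      fix i n j assume ij: "i \<in> {n\<in>A k. \<not> y n < k + 2 * d}" "j \<in> {n\<in>A k. \<not> y n < k + 2 * d}" "i \<le> n" "n \<le> j"
      then have "\<theta> i \<le> \<theta> n" "\<theta> n \<le> \<theta> j" using mono by (auto simp: A_iff)
      then show "n \<in> {n\<in>A k. \<not> y n < k + 2 * d}" using ij by (auto simp: A_iff y_def)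
    next
      fix n assume n: "n \<in> {n\<in>A k. \<not> y n < k + 2 * d}"
      then show "k + (p - d) \<le> x (Suc n) - x n \<and> x (Suc n) - x n \<le> k + (s - d)"
        using that(3)[of n] by (simp add: y_def \<theta>_def)
    next
      fix n assume "Suc n < N"
      then show "x (Suc n) - x n \<le> x (Suc (Suc n)) - x (Suc n)"
        using sp[of n] lam by (simp add: \<theta>_def)
    qed (use that(1,2) in \<open>auto simp: A_def\<close>)
    then show ?thesis by (simp add: algebra_simps)
  qed
  have far_full: "norm (\<Sum>n\<in>{n\<in>A k. \<not> y n < k + 2 * d}. e_fun (x n)) \<le> 2 * D" for k
  proof -
    have "norm (\<Sum>n\<in>{n\<in>A k. \<not> y n < k + 2 * d}. e_fun (x n))
        \<le> 1 / (pi * (2 * d - d)) + 1 / (pi * (1 - 1 + d))"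
      using d0 by (intro far) (auto simp: A_iff)
    then show ?thesis by (simp add: D_def)
  qed
  have full: "norm (\<Sum>n\<in>A k. e_fun (x n)) \<le> 4 * D + 1" for k
  proof -
    have "norm (\<Sum>n\<in>A k. e_fun (x n)) \<le> ((2 * d - 0) / lam + 1) + 2 * D"
    proof (rule block)
      show "norm (\<Sum>n\<in>{n\<in>A k. y n < k + 2 * d}. e_fun (x n)) \<le> (2 * d - 0) / lam + 1"
        using d0 by (intro near) (auto simp: A_iff)
    qed (rule far_full)
    then show ?thesis using d0 by (simp add: dl)
  qed
  \<comment> \<open>The right side is the chord of the convex function 1/(pi w) over [d, 1]: its
    values at the ends are D and D d = 1/pi.\<close>
  have conc: "1 / (pi * w) \<le> D * (1 + d - w)" if "d \<le> w" "w \<le> 1" for w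
  proof -
    have "0 \<le> (w - d) * (1 - w)" using that by simp
    then have "d \<le> w * (1 + d - w)" by (simp add: algebra_simps)
    then show ?thesis using d0 that by (simp add: D_def field_simps)
  qed
  define k0 k1 where "k0 = \<lfloor>y 0\<rfloor>" and "k1 = \<lfloor>y (N - 1)\<rfloor>"
  define p s where "p = y 0 - k0" and "s = y (N - 1) - k1"
  have ps: "0 \<le> p" "p < 1" "0 \<le> s" "s < 1"
    by (auto simp: p_def s_def k0_def k1_def) linarith+
  have R: "\<theta> (N - 1) - \<theta> 0 = of_int (k1 - k0) + s - p"
    by (simp add: p_def s_def y_def)
  \<comment> \<open>If p < 2d, the near piece loses its initial part, which saves p D/d terms.
    Otherwise it is empty, and the chord bound at w = p - d makes the cost of the far piece decrease
    linearly in p.\<close>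
  have first: "norm (\<Sum>n\<in>A k0. e_fun (x n)) \<le> (if p < 2 * d then 4 * D + 1 - p * D / d else 2 * D - p * D + 2 / pi)"
  proof -
    have yn: "p \<le> y n - k0" if "n \<in> A k0" for n
      using that mono[of 0 n] by (auto simp: A_iff y_def p_def)
    show ?thesis
    proof (cases "p < 2 * d")
      case True
      have "norm (\<Sum>n\<in>A k0. e_fun (x n)) \<le> ((2 * d - p) / lam + 1) + 2 * D"
      proof (rule block)
        show "norm (\<Sum>n\<in>{n\<in>A k0. y n < k0 + 2 * d}. e_fun (x n)) \<le> (2 * d - p) / lam + 1"
          using True yn by (intro near) auto
      qed (rule far_full)
      then show ?thesis using True d0 by (simp add: dl diff_divide_distrib left_diff_distrib)
    next
      case False
      have "{n\<in>A k0. y n < k0 + 2 * d} = {}" using False yn by fastforce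
      then have nr: "norm (\<Sum>n\<in>{n\<in>A k0. y n < k0 + 2 * d}. e_fun (x n)) \<le> 0"
        by (simp only: sum.empty norm_zero)
      have "norm (\<Sum>n\<in>A k0. e_fun (x n)) \<le> 0 + (1 / (pi * (p - d)) + 1 / (pi * (1 - 1 + d)))"
        by (rule block[OF nr], rule far) (use d0 d4 False yn in \<open>auto simp: A_iff\<close>)
      moreover have "1 / (pi * (p - d)) \<le> D * (1 + d - (p - d))"
        using False ps d0 by (intro conc) auto
      moreover have "D * (1 + d - (p - d)) = D - p * D + 2 / pi" using d0 by (simp add: D_def field_simps)
      ultimately show ?thesis using False by (simp add: D_def)
    qed
  qed
  \<comment> \<open>The near piece is charged in full here; the chord bound at w = 1 - s + d charges
    D s for the cut end of the far piece.\<close>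
  have last: "norm (\<Sum>n\<in>A k1. e_fun (x n)) \<le> 3 * D + 1 + D * s"
  proof -
    have yn: "y n - k1 \<le> s" if "n \<in> A k1" for n
      using that mono[of n "N - 1"] by (auto simp: A_iff y_def s_def)
    have nr: "norm (\<Sum>n\<in>{n\<in>A k1. y n < k1 + 2 * d}. e_fun (x n)) \<le> 2 * D + 1"
    proof -
      have "norm (\<Sum>n\<in>{n\<in>A k1. y n < k1 + 2 * d}. e_fun (x n)) \<le> (2 * d - 0) / lam + 1"
        using d0 by (intro near) (auto simp: A_iff)
      then show ?thesis using d0 by (simp add: dl)
    qed
    show ?thesis
    proof (cases "s < 2 * d")
      case True
      then have "{n\<in>A k1. \<not> y n < k1 + 2 * d} = {}" using yn by fastforce
      then have fr: "norm (\<Sum>n\<in>{n\<in>A k1. \<not> y n < k1 + 2 * d}. e_fun (x n)) \<le> 0"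
        by (simp only: sum.empty norm_zero)
      have "norm (\<Sum>n\<in>A k1. e_fun (x n)) \<le> (2 * D + 1) + 0"
        by (rule block[OF nr fr])
      moreover have "0 \<le> D * s" using D0 ps by simp
      ultimately show ?thesis using D0 by linarith
    next
      case False
      have "norm (\<Sum>n\<in>A k1. e_fun (x n)) \<le> (2 * D + 1) + (1 / (pi * (2 * d - d)) + 1 / (pi * (1 - s + d)))"
        by (rule block[OF nr], rule far) (use d0 ps yn in auto)
      moreover have "1 / (pi * (1 - s + d)) \<le> D * (1 + d - (1 - s + d))"
        using ps d0 False by (intro conc) auto
      ultimately show ?thesis by (simp add: D_def)
    qed
  qed
  have k01: "k0 \<le> k1" using mono[of 0 "N - 1"] N by (simp add: k0_def k1_def y_def floor_mono)
  have "(\<Sum>n<N. e_fun (x n)) = (\<Sum>k\<in>{k0..k1}. \<Sum>n\<in>{n\<in>{..<N}. \<lfloor>y n\<rfloor> = k}. e_fun (x n))"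
  proof (rule sum.group[symmetric])
    show "(\<lambda>n. \<lfloor>y n\<rfloor>) ` {..<N} \<subseteq> {k0..k1}"
      using mono[of 0] mono[of _ "N - 1"] by (auto simp: k0_def k1_def y_def intro!: floor_mono)
  qed auto
  also have "\<dots> = (\<Sum>k\<in>{k0..k1}. \<Sum>n\<in>A k. e_fun (x n))" by (simp add: A_def)
  also have "norm \<dots> \<le> (\<Sum>k\<in>{k0..k1}. norm (\<Sum>n\<in>A k. e_fun (x n)))" by (rule norm_sum)
  also have "\<dots> \<le> (of_int (k1 - k0) + s - p + 1) * (4 * D + 1) + 1"
  proof (cases "k0 = k1")
    case True
    have "0 \<le> s - p" using True mono[of 0 "N - 1"] N by (simp add: s_def p_def y_def)
    then have "0 \<le> (s - p) * (4 * D + 1)" using D0 by simp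
    then show ?thesis using full[of k0] True by (simp add: algebra_simps)
  next
    case False
    have "{k0..k1} = insert k0 (insert k1 {k0<..<k1})" using k01 by auto
    then have "(\<Sum>k\<in>{k0..k1}. norm (\<Sum>n\<in>A k. e_fun (x n))) = norm (\<Sum>n\<in>A k0. e_fun (x n))
        + (norm (\<Sum>n\<in>A k1. e_fun (x n)) + (\<Sum>k\<in>{k0<..<k1}. norm (\<Sum>n\<in>A k. e_fun (x n))))"
      using False by simp
    also have "(\<Sum>k\<in>{k0<..<k1}. norm (\<Sum>n\<in>A k. e_fun (x n))) \<le> of_nat (card {k0<..<k1}) * (4 * D + 1)"
      using full by (rule sum_bounded_above)
    also have "of_nat (card {k0<..<k1}) = (of_int (k1 - k0) - 1 :: real)" using False k01 by simp
    also have "norm (\<Sum>n\<in>A k0. e_fun (x n)) + (norm (\<Sum>n\<in>A k1. e_fun (x n)) + (of_int (k1 - k0) - 1) * (4 * D + 1))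
        \<le> (of_int (k1 - k0) + s - p + 1) * (4 * D + 1) + 1"
    proof -
      \<comment> \<open>The k1 - k0 - 1 inner blocks are charged 4D + 1 each, so this is what
        remains of the target for the two end blocks.\<close>
      have "norm (\<Sum>n\<in>A k0. e_fun (x n)) + norm (\<Sum>n\<in>A k1. e_fun (x n)) \<le> (2 + s - p) * (4 * D + 1) + 1"
      proof -
        have expand: "(2 + s - p) * (4 * D + 1) + 1 = 8 * D + 4 * (D * s) - 4 * (p * D) + 3 + s - p"
          by (simp add: algebra_simps)
        show ?thesis
        proof (cases "p < 2 * d")
          case True
          have "4 * (p * D) \<le> p * D / d"
          proof -
            have "p * D * (4 * d) \<le> p * D * 1" using d4 D0 ps by (intro mult_left_mono) auto
            then show ?thesis using d0 by (simp add: field_simps)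
          qed
          moreover have "0 \<le> D * s" using D0 ps by simp
          moreover have "norm (\<Sum>n\<in>A k0. e_fun (x n)) \<le> 4 * D + 1 - p * D / d" using first True by simp
          moreover note last expand ps
          ultimately show ?thesis using True D0 by linarith
        next
          case False
          have "0 \<le> D * (1 + s - p)" using D0 ps by (intro mult_nonneg_nonneg) auto
          then have "0 \<le> D + D * s - p * D" by (simp add: algebra_simps)
          moreover have "2 / pi \<le> 1" using pi_gt3 by simp
          moreover have "norm (\<Sum>n\<in>A k0. e_fun (x n)) \<le> 2 * D - p * D + 2 / pi" using first False by simp
          moreover note last expand ps
          ultimately show ?thesis using D0 by linarith
        qed
      qed
      then show ?thesis by (simp add: algebra_simps)
    qed
    finally show ?thesis by simp
  qed
  finally show ?thesis unfolding R D_eq .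
qed

text \<open>For \<open>lam >= pi / 16\<close> the product of h lam and 4/sqrt(pi lam) is at least 1,
  so the bound exceeds the number of terms. Otherwise the spaced bound applies, the range of the
  first differences being at most N h lam.\<close>

lemma second_difference_test:
  fixes x :: "nat \<Rightarrow> real"
  assumes lam: "0 < lam" and h: "1 \<le> h"
    and dif: "\<And>n. n + 2 < N \<Longrightarrow> lam \<le> x (n + 2) - 2 * x (n + 1) + x n \<and> x (n + 2) - 2 * x (n + 1) + x n \<le> h * lam"
  shows "norm (\<Sum>n<N. e_fun (x n)) \<le> (real N * h * lam + 1) * (4 / sqrt (pi * lam) + 1) + 1"
proof (cases "N = 0 \<or> pi / 16 \<le> lam")
  case True
  have "real N \<le> real N * h * lam * (4 / sqrt (pi * lam))"
  proof (cases "N = 0")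
    case False
    then have "pi * pi \<le> (16 * lam) * pi" using True by (intro mult_right_mono) auto
    have "pi * lam \<le> (4 * lam)\<^sup>2" using True False lam by (simp add: power2_eq_square)
    then have "sqrt (pi * lam) \<le> 4 * lam" using lam by (intro real_le_lsqrt) auto
    also have "\<dots> \<le> 4 * (h * lam)" using lam h by simp
    finally have "1 \<le> h * lam * (4 / sqrt (pi * lam))" using lam by (simp add: field_simps)
    then have "real N * 1 \<le> real N * (h * lam * (4 / sqrt (pi * lam)))" by (intro mult_left_mono) auto
    then show ?thesis by (simp add: mult.assoc)
  qed simp
  moreover have "0 \<le> real N * h * lam" "0 \<le> 4 / sqrt (pi * lam)" using lam h by auto
  moreover have "norm (\<Sum>n<N. e_fun (x n)) \<le> real N"
    using norm_sum_e_fun_le_card[of x "{..<N}"] by simp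
  ultimately show ?thesis by (simp only: distrib_right distrib_left mult_1_left mult_1_right)
next
  case False
  \<comment> \<open>N terms have only N - 1 first differences, but the spaced bound refers to N of
    them. One more term is appended, with second difference exactly \<open>lam\<close>. For N = 1
    the truncated index \<open>N - 2\<close> is 0; no spacing condition is then imposed.\<close>
  define z where "z n = (if n < N then x n else 2 * x (N - 1) - x (N - 2) + lam)" for n
  define \<theta> where "\<theta> n = z (Suc n) - z n" for n
  have st: "\<theta> n + lam \<le> \<theta> (Suc n) \<and> \<theta> (Suc n) \<le> \<theta> n + h * lam" if "Suc n < N" for n
  proof (cases "n + 2 < N")
    case True
    then show ?thesis using dif[of n] by (simp add: \<theta>_def z_def)
  next
    case F: False
    then have "N = n + 2" using that by simp
    then show ?thesis using lam h by (simp add: \<theta>_def z_def)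
  qed
  have "norm (\<Sum>n<N. e_fun (z n)) \<le> (\<theta> (N - 1) - \<theta> 0 + 1) * (4 / sqrt (pi * lam) + 1) + 1"
    unfolding \<theta>_def by (rule spaced_e_sum_bound) (use False lam st in \<open>auto simp: \<theta>_def\<close>)
  moreover have "(\<theta> (N - 1) - \<theta> 0 + 1) * (4 / sqrt (pi * lam) + 1) \<le> (real N * h * lam + 1) * (4 / sqrt (pi * lam) + 1)"
  proof -
    have "\<theta> n \<le> \<theta> 0 + real n * (h * lam)" if "n < N" for n
      using that
    proof (induction n)
      case (Suc n)
      then show ?case using st[of n] by (simp add: algebra_simps)
    qed simp
    from this[of "N - 1"] have "\<theta> (N - 1) - \<theta> 0 \<le> real (N - 1) * (h * lam)" using False by simp
    also have "\<dots> \<le> real N * (h * lam)" using lam h by (intro mult_right_mono) auto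
    finally show ?thesis
      using lam by (intro mult_right_mono) (auto simp: mult.assoc add_nonneg_nonneg)
  qed
  moreover have "(\<Sum>n<N. e_fun (z n)) = (\<Sum>n<N. e_fun (x n))" by (simp add: z_def)
  ultimately show ?thesis by (metis add_right_mono order_trans)
qed


subsection \<open>The Weyl-van der Corput inequality\<close>

text \<open>The argument of g is |i - j| on naturals, and each distance m > 0 occurs for 2(M - m)
  ordered pairs. Passing from M to M + 1 adds the distances 1, ..., M twice and 0 once.\<close>

lemma sum_abs_diff:
  fixes g :: "nat \<Rightarrow> real"
  shows "(\<Sum>i<M. \<Sum>j<M. g (if i \<le> j then j - i else i - j)) = real M * g 0 + 2 * (\<Sum>m=1..<M. real (M - m) * g m)"
proof (induction M)
  case (Suc M)
  let ?d = "\<lambda>i j. g (if i \<le> j then j - i else i - j)"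
  have r: "(\<Sum>i<M. g (M - i)) = (\<Sum>m=1..M. g m)"
    by (rule sum.reindex_bij_witness[of _ "\<lambda>m. M - m" "\<lambda>i. M - i"]) auto
  have "(\<Sum>i<Suc M. \<Sum>j<Suc M. ?d i j) = (\<Sum>i<M. \<Sum>j<M. ?d i j) + (\<Sum>i<M. ?d i M) + (\<Sum>j<M. ?d M j) + g 0"
    by (simp add: sum.distrib)
  also have "(\<Sum>i<M. ?d i M) = (\<Sum>m=1..M. g m)" unfolding r[symmetric] by (intro sum.cong) auto
  also have "(\<Sum>j<M. ?d M j) = (\<Sum>m=1..M. g m)" unfolding r[symmetric] by (intro sum.cong) auto
  also have "(\<Sum>m=1..M. g m) = (\<Sum>m=1..<Suc M. g m)" by (simp add: atLeastLessThanSuc_atLeastAtMost)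
  finally have "(\<Sum>i<Suc M. \<Sum>j<Suc M. ?d i j)
      = real (Suc M) * g 0 + 2 * ((\<Sum>m=1..<M. real (M - m) * g m) + (\<Sum>m=1..<Suc M. g m))"
    by (simp add: Suc.IH algebra_simps)
  also have "(\<Sum>m=1..<M. real (M - m) * g m) = (\<Sum>m=1..<Suc M. real (M - m) * g m)"
    by (cases "M = 0") auto
  also have "\<dots> + (\<Sum>m=1..<Suc M. g m) = (\<Sum>m=1..<Suc M. real (Suc M - m) * g m)"
    unfolding sum.distrib[symmetric] by (intro sum.cong) (auto simp: Suc_diff_le algebra_simps)
  finally show ?case .
qed simp

text \<open>A bridge from sums of zero-extended terms over the integers to sums over
  \<open>{..<k}\<close>: within T the support lies in the window of length k starting at s.\<close>

lemma sum_int_shift: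
  fixes f :: "int \<Rightarrow> complex"
  assumes "finite T" "\<And>n. n < k \<Longrightarrow> int n + s \<in> T" "\<And>t. t \<in> T \<Longrightarrow> t < s \<or> s + int k \<le> t \<Longrightarrow> f t = 0"
  shows "(\<Sum>t\<in>T. f t) = (\<Sum>n<k. f (int n + s))"
proof -
  have "(\<Sum>n<k. f (int n + s)) = (\<Sum>t\<in>{s..<s + int k}. f t)"
    by (rule sum.reindex_bij_witness[of _ "\<lambda>t. nat (t - s)" "\<lambda>n. int n + s"]) auto
  also have "\<dots> = (\<Sum>t\<in>T. f t)"
  proof (rule sum.mono_neutral_left)
    show "{s..<s + int k} \<subseteq> T"
    proof
      fix t assume "t \<in> {s..<s + int k}"
      then show "t \<in> T" using assms(2)[of "nat (t - s)"] by auto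
    qed
  qed (use assms in auto)
  finally show ?thesis by simp
qed

text \<open>Each term occurs in exactly M windows of length M, so the window sums \<open>w t\<close>
  add up to M S. Cauchy-Schwarz over the N + M - 1 positions of T leaves correlations whose norms
  depend only on |i - j|.\<close>

lemma weyl_van_der_corput:
  fixes x :: "nat \<Rightarrow> real"
  assumes M: "0 < M"
  shows "(norm (\<Sum>n<N. e_fun (x n)))\<^sup>2
    \<le> real (N + M - 1) / real M *
       (real N + 2 * (\<Sum>m=1..<M. (1 - real m / real M) * norm (\<Sum>n<N - m. e_fun (x (n + m) - x n))))"
proof -
  \<comment> \<open>Zero extension to integer indices avoids boundary terms; subtraction on naturals
    would send all negative positions to 0.\<close>
  define y where "y i = (if 0 \<le> i \<and> i < int N then e_fun (x (nat i)) else 0)" for i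
  define T where "T = {0..<int (N + M) - 1}"
  define w where "w t = (\<Sum>j<M. y (t - int j))" for t
  define S where "S = (\<Sum>n<N. e_fun (x n))"
  define C where "C m = norm (\<Sum>n<N - m. e_fun (x (n + m) - x n))" for m
  have fin: "finite T" by (simp add: T_def)
  have card_T: "card T = N + M - 1" using M by (simp add: T_def)
  have "(\<Sum>t\<in>T. w t) = (\<Sum>j<M. \<Sum>t\<in>T. y (t - int j))"
    unfolding w_def by (rule sum.swap)
  also have "\<dots> = (\<Sum>j<M. S)"
  proof (rule sum.cong[OF refl])
    fix j assume j: "j \<in> {..<M}"
    have "(\<Sum>t\<in>T. y (t - int j)) = (\<Sum>n<N. y (int n + int j - int j))"
      by (rule sum_int_shift[OF fin]) (use j in \<open>auto simp: T_def y_def\<close>)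
    then show "(\<Sum>t\<in>T. y (t - int j)) = S" by (simp add: S_def y_def)
  qed
  finally have sum_w: "(\<Sum>t\<in>T. w t) = of_nat M * S" by simp
  have corr: "norm (\<Sum>t\<in>T. y (t - int i) * cnj (y (t - int j))) = C (j - i)"
    if "i \<le> j" "j < M" for i j
  proof -
    have "(\<Sum>t\<in>T. y (t - int i) * cnj (y (t - int j)))
        = (\<Sum>n<N - (j - i). y (int n + int j - int i) * cnj (y (int n + int j - int j)))"
      by (rule sum_int_shift[OF fin]) (use that in \<open>auto simp: T_def y_def\<close>)
    also have "\<dots> = (\<Sum>n<N - (j - i). e_fun (x (n + (j - i)) - x n))"
    proof (rule sum.cong[OF refl])
      fix n assume n: "n \<in> {..<N - (j - i)}"
      have yn: "y (int m) = e_fun (x m)" if "m < N" for m using that by (simp add: y_def)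
      have eq: "int n + int j - int i = int (n + (j - i))" "int n + int j - int j = int n" using that by auto
      have "n + (j - i) < N" "n < N" using n by auto
      then show "y (int n + int j - int i) * cnj (y (int n + int j - int j)) = e_fun (x (n + (j - i)) - x n)"
        unfolding eq by (simp only: yn e_fun_diff)
    qed
    finally show ?thesis by (simp add: C_def)
  qed
  have corr': "norm (\<Sum>t\<in>T. y (t - int i) * cnj (y (t - int j))) = C (if i \<le> j then j - i else i - j)"
    if "i < M" "j < M" for i j
  proof (cases "i \<le> j")
    case False
    have "(\<Sum>t\<in>T. y (t - int i) * cnj (y (t - int j))) = cnj (\<Sum>t\<in>T. y (t - int j) * cnj (y (t - int i)))"
      by (simp add: mult.commute)
    then have "norm (\<Sum>t\<in>T. y (t - int i) * cnj (y (t - int j))) = norm (\<Sum>t\<in>T. y (t - int j) * cnj (y (t - int i)))"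
      by (simp only: complex_mod_cnj)
    then show ?thesis using corr[of j i] False that by simp
  qed (use corr that in simp)
  have "complex_of_real (\<Sum>t\<in>T. (norm (w t))\<^sup>2) = (\<Sum>t\<in>T. w t * cnj (w t))"
    by (simp only: of_real_sum complex_norm_square)
  also have "\<dots> = (\<Sum>t\<in>T. \<Sum>i<M. \<Sum>j<M. y (t - int i) * cnj (y (t - int j)))"
    by (simp add: w_def sum_product)
  also have "\<dots> = (\<Sum>i<M. \<Sum>t\<in>T. \<Sum>j<M. y (t - int i) * cnj (y (t - int j)))"
    by (rule sum.swap)
  also have "\<dots> = (\<Sum>i<M. \<Sum>j<M. \<Sum>t\<in>T. y (t - int i) * cnj (y (t - int j)))"
    by (intro sum.cong refl sum.swap)
  finally have eq: "complex_of_real (\<Sum>t\<in>T. (norm (w t))\<^sup>2) = (\<Sum>i<M. \<Sum>j<M. \<Sum>t\<in>T. y (t - int i) * cnj (y (t - int j)))" .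
  have "(\<Sum>t\<in>T. (norm (w t))\<^sup>2) = norm (complex_of_real (\<Sum>t\<in>T. (norm (w t))\<^sup>2))"
    unfolding norm_of_real by (simp add: sum_nonneg)
  also have "\<dots> \<le> (\<Sum>i<M. \<Sum>j<M. norm (\<Sum>t\<in>T. y (t - int i) * cnj (y (t - int j))))"
    unfolding eq by (rule order.trans[OF norm_sum], rule sum_mono, rule norm_sum)
  also have "\<dots> = (\<Sum>i<M. \<Sum>j<M. C (if i \<le> j then j - i else i - j))"
    by (intro sum.cong refl corr') auto
  also have "\<dots> = real M * C 0 + 2 * (\<Sum>m=1..<M. real (M - m) * C m)"
    by (rule sum_abs_diff)
  also have "C 0 = real N"
    using e_fun_of_int[of 0] by (simp add: C_def del: e_fun_of_int)
  also have "(\<Sum>m=1..<M. real (M - m) * C m) = real M * (\<Sum>m=1..<M. (1 - real m / real M) * C m)"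
    unfolding sum_distrib_left by (intro sum.cong) (use M in \<open>auto simp: field_simps of_nat_diff\<close>)
  finally have W: "(\<Sum>t\<in>T. (norm (w t))\<^sup>2) \<le> real M * (real N + 2 * (\<Sum>m=1..<M. (1 - real m / real M) * C m))"
    by (simp add: algebra_simps)
  have "(real M * norm S)\<^sup>2 = (norm (\<Sum>t\<in>T. w t))\<^sup>2"
    by (simp add: sum_w norm_mult)
  also have "\<dots> \<le> (\<Sum>t\<in>T. norm (w t))\<^sup>2"
    by (intro power_mono norm_sum) simp
  also have "\<dots> \<le> (\<Sum>t\<in>T. (norm (w t))\<^sup>2) * real (card T)"
    by (rule sum_squared_le_sum_of_squares)
  also have "\<dots> \<le> real M * (real N + 2 * (\<Sum>m=1..<M. (1 - real m / real M) * C m)) * real (N + M - 1)"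
    unfolding card_T using W by (intro mult_right_mono) auto
  finally have "real M * (real M * (norm S)\<^sup>2)
      \<le> real M * ((real N + 2 * (\<Sum>m=1..<M. (1 - real m / real M) * C m)) * real (N + M - 1))"
    by (simp add: power2_eq_square algebra_simps)
  then have "real M * (norm S)\<^sup>2 \<le> (real N + 2 * (\<Sum>m=1..<M. (1 - real m / real M) * C m)) * real (N + M - 1)"
    using M by (simp only: mult_le_cancel_left_pos of_nat_0_less_iff)
  then show ?thesis
    using M unfolding S_def C_def by (simp add: pos_le_divide_eq mult.commute)
qed

subsection \<open>Weighted power sums\<close>

text \<open>Let the right end u vary: the derivative of the defect \<open>H\<close> is half of g u -
  g a - (u - a) g' u, which is nonnegative because the mean slope of the concave g on [a, u] is at
  least its slope at u.\<close>

lemma trapezoid_le_integral: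
  fixes G g g' :: "real \<Rightarrow> real"
  assumes "a \<le> b"
    and G: "\<And>t. a \<le> t \<Longrightarrow> t \<le> b \<Longrightarrow> (G has_real_derivative g t) (at t)"
    and g: "\<And>t. a \<le> t \<Longrightarrow> t \<le> b \<Longrightarrow> (g has_real_derivative g' t) (at t)"
    and anti: "\<And>s t. a \<le> s \<Longrightarrow> s \<le> t \<Longrightarrow> t \<le> b \<Longrightarrow> g' t \<le> g' s"
  shows "(b - a) * (g a + g b) / 2 \<le> G b - G a"
proof -
  define H where "H u = G u - (u - a) * (g a + g u) / 2" for u
  have "\<exists>d. (H has_real_derivative d) (at u) \<and> 0 \<le> d" if u: "a \<le> u" "u \<le> b" for u
  proof -
    have "(H has_real_derivative (g u - ((g a + g u) + (u - a) * g' u) / 2)) (at u)"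
      unfolding H_def using G[OF u] g[OF u] by (auto intro!: derivative_eq_intros)
    moreover have "(u - a) * g' u \<le> g u - g a"
    proof (cases "a < u")
      case True
      then obtain z where z: "a < z" "z < u" "g u - g a = (u - a) * g' z"
        using MVT2[of a u g g'] g u by force
      then show ?thesis using anti[of z u] u by (simp add: mult_left_mono)
    qed (use u in simp)
    ultimately show ?thesis by (intro exI[of _ "g u - ((g a + g u) + (u - a) * g' u) / 2"]) (simp add: field_simps)
  qed
  then have "H a \<le> H b" using assms(1) by (intro DERIV_nonneg_imp_nondecreasing[of a b H]) auto
  then show ?thesis by (simp add: H_def)
qed

lemma DERIV_powr_divide:
  fixes r t :: real
  assumes "0 < t" "r \<noteq> 0"
  shows "((\<lambda>t. t powr r / r) has_real_derivative t powr (r - 1)) (at t)"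
  using DERIV_cdivide[OF has_real_derivative_powr[OF assms(1), of r], of r] assms(2) by simp

text \<open>The weighted summand is concave and vanishes at both ends of $[0, M]$, so the sum is exactly
its trapezoidal sum, which underestimates the integral.\<close>

lemma sum_weighted_powr_le:
  fixes \<alpha> :: real
  assumes \<alpha>: "0 \<le> \<alpha>" "\<alpha> \<le> 1" and M: "0 < M"
  shows "(\<Sum>m=1..<M. (1 - real m / real M) * real m powr \<alpha>) \<le> real M powr (1 + \<alpha>) / ((1 + \<alpha>) * (2 + \<alpha>))"
proof -
  define G where "G t = real M * (t powr (1 + \<alpha>) / (1 + \<alpha>)) - t powr (2 + \<alpha>) / (2 + \<alpha>)" for t
  define g where "g t = real M * t powr \<alpha> - t powr (1 + \<alpha>)" for t
  define g' where "g' t = real M * (\<alpha> * t powr (\<alpha> - 1)) - (1 + \<alpha>) * t powr \<alpha>" for t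
  have G: "(G has_real_derivative g t) (at t)" if "0 < t" for t
    unfolding G_def g_def
    using DERIV_diff[OF DERIV_cmult[OF DERIV_powr_divide[of t "1 + \<alpha>"], of "real M"] DERIV_powr_divide[of t "2 + \<alpha>"]] that \<alpha>
    by (simp add: algebra_simps)
  have g: "(g has_real_derivative g' t) (at t)" if "0 < t" for t
    unfolding g_def g'_def
    using DERIV_diff[OF DERIV_cmult[OF has_real_derivative_powr[OF that, of \<alpha>], of "real M"] has_real_derivative_powr[OF that, of "1 + \<alpha>"]]
    by simp
  have anti: "g' t \<le> g' s" if "0 < s" "s \<le> t" for s t
    unfolding g'_def using that \<alpha>
    by (intro diff_mono mult_left_mono powr_mono2 powr_mono2') auto
  have "(\<Sum>m=1..<k. g (real m)) + g (real k) / 2 \<le> G (real k)" if "1 \<le> k" for k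
    using that
  proof (induction k rule: dec_induct)
    \<comment> \<open>The induction starts at 1 because \<open>g'\<close> contains the power
      \<open>\<alpha>\<close> - 1, which may be singular at 0; the contribution of [0, 1] is
      compared directly.\<close>
    case base
    have "real M / 2 \<le> real M / (1 + \<alpha>)" using \<alpha> by (intro divide_left_mono) auto
    moreover have "1 / (2 + \<alpha>) \<le> 1 / 2" using \<alpha> by (intro divide_left_mono) auto
    ultimately have "real M / 2 - 1 / 2 \<le> real M / (1 + \<alpha>) - 1 / (2 + \<alpha>)" by linarith
    then show ?case by (simp add: g_def G_def diff_divide_distrib)
  next
    case (step k)
    have "(real (Suc k) - real k) * (g (real k) + g (real (Suc k))) / 2 \<le> G (real (Suc k)) - G (real k)"
      by (rule trapezoid_le_integral[of _ _ G g g']) (use step.hyps in \<open>auto intro!: G g anti\<close>)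
    then show ?case using step by simp
  qed
  from this[of M] M have "(\<Sum>m=1..<M. g (real m)) + g (real M) / 2 \<le> G (real M)" by simp
  moreover have "g (real M) = 0" using M by (simp add: g_def powr_add)
  moreover have "G (real M) = real M * (real M powr (1 + \<alpha>) / ((1 + \<alpha>) * (2 + \<alpha>)))"
  proof -
    have "real M powr (2 + \<alpha>) = real M * real M powr (1 + \<alpha>)"
      using M by (simp add: powr_add power2_eq_square)
    then have "G (real M) = real M * real M powr (1 + \<alpha>) * (1 / (1 + \<alpha>) - 1 / (2 + \<alpha>))"
      by (simp add: G_def algebra_simps)
    also have "1 / (1 + \<alpha>) - 1 / (2 + \<alpha>) = 1 / ((1 + \<alpha>) * (2 + \<alpha>))"
      using \<alpha> by (simp add: field_simps)
    finally show ?thesis by simp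
  qed
  moreover have "(\<Sum>m=1..<M. g (real m)) = real M * (\<Sum>m=1..<M. (1 - real m / real M) * real m powr \<alpha>)"
    unfolding sum_distrib_left g_def using M by (intro sum.cong) (auto simp: powr_add field_simps)
  ultimately have "real M * (\<Sum>m=1..<M. (1 - real m / real M) * real m powr \<alpha>)
      \<le> real M * (real M powr (1 + \<alpha>) / ((1 + \<alpha>) * (2 + \<alpha>)))"
    by linarith
  then show ?thesis using M by (simp only: mult_le_cancel_left_pos of_nat_0_less_iff)
qed

text \<open>For a negative exponent the summand is convex, so the trapezoidal comparison would point
  the wrong way. But it is decreasing, and each term is at most the integral over the unit interval
  to its left.\<close>

lemma sum_weighted_powr_neg_le:
  fixes \<beta> :: real
  assumes \<beta>: "0 < \<beta>" "\<beta> < 1" and M: "0 < M"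
  shows "(\<Sum>m=1..<M. (1 - real m / real M) * real m powr (- \<beta>)) \<le> real M powr (1 - \<beta>) / ((1 - \<beta>) * (2 - \<beta>))"
proof -
  define G where "G t = real M * (t powr (1 - \<beta>) / (1 - \<beta>)) - t powr (2 - \<beta>) / (2 - \<beta>)" for t
  define g where "g t = real M * t powr (- \<beta>) - t powr (1 - \<beta>)" for t
  have G: "(G has_real_derivative g t) (at t)" if "0 < t" for t
    unfolding G_def g_def
    using DERIV_diff[OF DERIV_cmult[OF DERIV_powr_divide[of t "1 - \<beta>"], of "real M"] DERIV_powr_divide[of t "2 - \<beta>"]] that \<beta>
    by (simp add: algebra_simps)
  have anti: "g t \<le> g s" if "0 < s" "s \<le> t" for s t
    unfolding g_def using that \<beta>
    by (intro diff_mono mult_left_mono powr_mono2 powr_mono2') auto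
  have "(\<Sum>m=1..<Suc k. g (real m)) \<le> G (real k)" if "1 \<le> k" for k
    using that
  proof (induction k rule: dec_induct)
    case base
    have "real M * 1 \<le> real M * (1 / (1 - \<beta>))" using \<beta> by (intro mult_left_mono) auto
    moreover have "1 / (2 - \<beta>) \<le> 1" using \<beta> by simp
    ultimately show ?case by (simp add: g_def G_def)
  next
    case (step k)
    obtain z where z: "real k < z" "z < real (Suc k)" "G (real (Suc k)) - G (real k) = (real (Suc k) - real k) * g z"
      using MVT2[of "real k" "real (Suc k)" G g] G step.hyps by force
    then have "g (real (Suc k)) \<le> G (real (Suc k)) - G (real k)"
      using anti[of z "real (Suc k)"] step.hyps by simp
    then show ?case using step by simp
  qed
  from this[of M] M have "(\<Sum>m=1..<M. g (real m)) + g (real M) \<le> G (real M)" by simp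
  moreover have "g (real M) = 0" using M by (simp add: g_def powr_diff powr_minus field_simps)
  moreover have "G (real M) = real M * (real M powr (1 - \<beta>) / ((1 - \<beta>) * (2 - \<beta>)))"
  proof -
    have "real M powr (2 - \<beta>) = real M * real M powr (1 - \<beta>)"
      using M by (simp add: powr_diff power2_eq_square)
    then have "G (real M) = real M * real M powr (1 - \<beta>) * (1 / (1 - \<beta>) - 1 / (2 - \<beta>))"
      by (simp add: G_def algebra_simps)
    also have "1 / (1 - \<beta>) - 1 / (2 - \<beta>) = 1 / ((1 - \<beta>) * (2 - \<beta>))"
      using \<beta> by (simp add: field_simps)
    finally show ?thesis by simp
  qed
  moreover have "(\<Sum>m=1..<M. g (real m)) = real M * (\<Sum>m=1..<M. (1 - real m / real M) * real m powr (- \<beta>))"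
    unfolding sum_distrib_left g_def using M by (intro sum.cong) (auto simp: powr_diff powr_minus field_simps)
  ultimately have "real M * (\<Sum>m=1..<M. (1 - real m / real M) * real m powr (- \<beta>))
      \<le> real M * (real M powr (1 - \<beta>) / ((1 - \<beta>) * (2 - \<beta>)))"
    by linarith
  then show ?thesis using M by (simp only: mult_le_cancel_left_pos of_nat_0_less_iff)
qed


subsection \<open>Third differences\<close>

primrec fdiff :: "nat \<Rightarrow> (nat \<Rightarrow> real) \<Rightarrow> nat \<Rightarrow> real" where
  "fdiff 0 x n = x n"
| "fdiff (Suc k) x n = fdiff k x (Suc n) - fdiff k x n"

text \<open>The k-th difference at n involves the terms n, ..., n + k, so \<open>n + k < N\<close>
  selects those that depend only on the N terms of the sum.\<close>

definition fdiff_between :: "nat \<Rightarrow> nat \<Rightarrow> real \<Rightarrow> real \<Rightarrow> (nat \<Rightarrow> real) \<Rightarrow> bool" where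
  "fdiff_between k N lo hi x \<longleftrightarrow> (\<forall>n. n + k < N \<longrightarrow> lo \<le> fdiff k x n \<and> fdiff k x n \<le> hi)"

lemma fdiff_shift_diff: "fdiff k (\<lambda>n. x (n + m) - x n) n = fdiff k x (n + m) - fdiff k x n"
  by (induction k arbitrary: n) auto

text \<open>The k-th difference of the shifted difference telescopes into m consecutive (k+1)-st
  differences of x.\<close>

lemma fdiff_between_shift_diff:
  assumes "fdiff_between (Suc k) N lo hi x"
  shows "fdiff_between k (N - m) (real m * lo) (real m * hi) (\<lambda>n. x (n + m) - x n)"
  unfolding fdiff_between_def
proof (intro allI impI)
  fix n assume n: "n + k < N - m"
  have "fdiff k x (n + m) - fdiff k x n = (\<Sum>i<m. fdiff (Suc k) x (n + i))"
    using sum_lessThan_telescope[of "\<lambda>i. fdiff k x (n + i)" m] by simp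
  moreover have "lo \<le> fdiff (Suc k) x (n + i) \<and> fdiff (Suc k) x (n + i) \<le> hi" if "i < m" for i
  proof -
    have "n + i + Suc k < N" using that n by linarith
    then show ?thesis using assms unfolding fdiff_between_def by blast
  qed
  ultimately show "real m * lo \<le> fdiff k (\<lambda>n. x (n + m) - x n) n \<and> fdiff k (\<lambda>n. x (n + m) - x n) n \<le> real m * hi"
    using sum_bounded_below[of "{..<m}" lo "\<lambda>i. fdiff (Suc k) x (n + i)"]
      sum_bounded_above[of "{..<m}" "\<lambda>i. fdiff (Suc k) x (n + i)" hi]
    by (simp only: fdiff_shift_diff card_lessThan) auto
qed

lemma second_fdiff_test:
  assumes "0 < lam" "1 \<le> h" "fdiff_between 2 N lam (h * lam) x"
  shows "norm (\<Sum>n<N. e_fun (x n)) \<le> (real N * h * lam + 1) * (4 / sqrt (pi * lam) + 1) + 1"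
proof (rule second_difference_test[OF assms(1,2)])
  fix n assume "n + 2 < N"
  then show "lam \<le> x (n + 2) - 2 * x (n + 1) + x n \<and> x (n + 2) - 2 * x (n + 1) + x n \<le> h * lam"
    using assms(3) by (auto simp: fdiff_between_def numeral_2_eq_2)
qed

section \<open>Identities and lower bounds for the initial constants\<close>

text \<open>The quadratic equation for d = \<open>(delta_tilde \<eta>)\<^sup>2\<close> amounts to (d
  - 1) B3^2 = \<open>\<eta>\<close>, the relation that absorbs the shift length for k = 3.\<close>

lemma delta_tilde_sq:
  assumes "0 < \<eta>"
  shows "(delta_tilde \<eta>)\<^sup>2 \<ge> 1"
    and "(delta_tilde \<eta>)\<^sup>2 * (delta_tilde \<eta>)\<^sup>2 = (delta_tilde \<eta>)\<^sup>2 + 3 * sqrt pi * (\<eta> * sqrt \<eta>) / 32"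
proof -
  define w where "w = 3/8 * sqrt pi * (\<eta> * sqrt \<eta>)"
  have w: "0 \<le> w" using assms by (simp add: w_def)
  have "\<eta> powr (3/2) = \<eta> powr (1 + 1/2)" by simp
  also have "\<dots> = \<eta> * sqrt \<eta>" using assms by (subst powr_add) (simp add: powr_half_sqrt)
  finally have "delta_tilde \<eta> = sqrt (1/2 + 1/2 * sqrt (1 + w))"
    by (simp add: delta_tilde_def w_def powr_half_sqrt)
  then have *: "(delta_tilde \<eta>)\<^sup>2 = 1/2 + 1/2 * sqrt (1 + w)" using w by simp
  have "1 \<le> sqrt (1 + w)" using w by simp
  then show "(delta_tilde \<eta>)\<^sup>2 \<ge> 1" unfolding * by linarith
  define s where "s = sqrt (1 + w)"
  have "s * s = 1 + w" using w by (simp add: s_def)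
  then have "(delta_tilde \<eta>)\<^sup>2 * (delta_tilde \<eta>)\<^sup>2 = (delta_tilde \<eta>)\<^sup>2 + w / 4"
    unfolding *[folded s_def] by (simp add: field_simps)
  then show "(delta_tilde \<eta>)\<^sup>2 * (delta_tilde \<eta>)\<^sup>2 = (delta_tilde \<eta>)\<^sup>2 + 3 * sqrt pi * (\<eta> * sqrt \<eta>) / 32"
    by (simp add: w_def)
qed

lemma delta_tilde_nonneg: "0 < \<eta> \<Longrightarrow> 0 \<le> delta_tilde \<eta>"
  by (simp add: delta_tilde_def)

lemma lambda0_cube_root:
  assumes "0 < \<eta>" "0 < h"
  shows "lambda0 \<eta> h powr (1/3) = 1 / (1 / \<eta> + 32 * sqrt \<eta> * h / (15 * sqrt pi))"
proof -
  have pos: "0 < 1 / \<eta> + 32 * sqrt \<eta> * h / (15 * sqrt pi)"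
    using assms by (intro add_pos_nonneg) auto
  have "lambda0 \<eta> h powr (1/3) = (1 / \<eta> + 32 * sqrt \<eta> * h / (15 * sqrt pi)) powr (- 1)"
    using assms by (simp add: lambda0_def powr_powr powr_half_sqrt)
  also have "\<dots> = 1 / (1 / \<eta> + 32 * sqrt \<eta> * h / (15 * sqrt pi))"
    using pos by (simp add: powr_minus_divide)
  finally show ?thesis .
qed

lemma B3_sq:
  assumes "0 < \<eta>"
  shows "(B3 \<eta>)\<^sup>2 = 32 / (3 * sqrt pi * sqrt \<eta>) * (delta_tilde \<eta>)\<^sup>2"
proof -
  have q: "(t powr (1/4))\<^sup>2 = sqrt t" if "0 < t" for t :: real
    using that by (simp add: powr_half_sqrt[symmetric] power2_eq_square powr_add[symmetric])
  show ?thesis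
    using assms by (simp add: B3_def power_mult_distrib power_divide q)
qed

lemma A3_sq:
  assumes "0 < \<eta>" "0 < h"
  defines "l \<equiv> lambda0 \<eta> h powr (1/3)"
  shows "(A3 \<eta> h)\<^sup>2 = (delta_tilde \<eta>)\<^sup>2 *
    (1 / (\<eta> * h) + 32 / (15 * sqrt pi) * sqrt (\<eta> + l) + 1/3 * (\<eta> + l) * l)"
proof -
  have "0 \<le> l" by (simp add: l_def)
  then have "0 \<le> 1 / (\<eta> * h) + 32 / (15 * sqrt pi) * sqrt (\<eta> + l) + 1/3 * (\<eta> + l) * l"
    using assms(1,2) by (intro add_nonneg_nonneg) auto
  then show ?thesis by (simp add: A3_def l_def power_mult_distrib)
qed

lemma A3_nonneg: "0 < \<eta> \<Longrightarrow> 0 < h \<Longrightarrow> 0 \<le> A3 \<eta> h"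
  unfolding A3_def by (intro mult_nonneg_nonneg delta_tilde_nonneg real_sqrt_ge_zero add_nonneg_nonneg) auto

lemma B3_nonneg: "0 < \<eta> \<Longrightarrow> 0 \<le> B3 \<eta>"
  unfolding B3_def by (intro mult_nonneg_nonneg delta_tilde_nonneg) auto

text \<open>Multiplied by h, the bracket is the reciprocal of the cube root of
  \<open>lambda0\<close>. Hence the A-term is at least N as soon as lambda reaches
  \<open>lambda0\<close>.\<close>

lemma A3_sq_ge:
  assumes "0 < \<eta>" "0 < h"
  shows "(delta_tilde \<eta>)\<^sup>2 * (1 / (\<eta> * h) + 32 / (15 * sqrt pi) * sqrt \<eta>) \<le> (A3 \<eta> h)\<^sup>2"
proof -
  define l where "l = lambda0 \<eta> h powr (1/3)"
  have l: "0 \<le> l" by (simp add: l_def)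
  have "32 / (15 * sqrt pi) * sqrt \<eta> \<le> 32 / (15 * sqrt pi) * sqrt (\<eta> + l)"
    using l by (intro mult_left_mono) auto
  moreover have "0 \<le> 1/3 * (\<eta> + l) * l" using l assms by simp
  ultimately show ?thesis
    unfolding A3_sq[OF assms, folded l_def] by (intro mult_left_mono) auto
qed

text \<open>Needed for the cross term of the squared bound. On squaring, the powers of
  \<open>\<eta>\<close> cancel and the numerical factor 1024/(45 pi) > 1 remains.\<close>

lemma A3_B3_ge:
  assumes "0 < \<eta>" "0 < h"
  shows "(delta_tilde \<eta>)\<^sup>2 \<le> A3 \<eta> h * B3 \<eta>"
proof -
  define d where "d = (delta_tilde \<eta>)\<^sup>2"
  have d: "0 \<le> d" by (simp add: d_def)
  have "d * (32 / (15 * sqrt pi) * sqrt \<eta>) \<le> d * (1 / (\<eta> * h) + 32 / (15 * sqrt pi) * sqrt \<eta>)"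
    using assms d by (intro mult_left_mono) auto
  then have A: "d * (32 / (15 * sqrt pi) * sqrt \<eta>) \<le> (A3 \<eta> h)\<^sup>2"
    using A3_sq_ge[OF assms] by (simp add: d_def)
  have "d\<^sup>2 * 1 \<le> d\<^sup>2 * (1024 / (45 * pi))"
    using pi_less_4 by (intro mult_left_mono) auto
  also have "\<dots> = (d * (32 / (15 * sqrt pi) * sqrt \<eta>)) * (32 / (3 * sqrt pi * sqrt \<eta>) * d)"
    using assms by (simp add: field_simps power2_eq_square)
  also have "\<dots> \<le> (A3 \<eta> h)\<^sup>2 * (B3 \<eta>)\<^sup>2"
    unfolding B3_sq[OF assms(1), folded d_def] using A d assms by (intro mult_right_mono) auto
  finally have "d\<^sup>2 \<le> (A3 \<eta> h * B3 \<eta>)\<^sup>2" by (simp add: power_mult_distrib)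
  then show ?thesis
    using A3_nonneg[OF assms] B3_nonneg[OF assms(1)] unfolding d_def[symmetric]
    by (intro power2_le_imp_le[of d "A3 \<eta> h * B3 \<eta>"]) (auto simp: d_def)
qed

lemma third_fdiff_test:
  assumes lam: "0 < lam" and h: "1 < h" and \<eta>: "0 < \<eta>" and N: "0 < N"
    and dif: "fdiff_between 3 N lam (h * lam) x"
  shows "norm (\<Sum>n<N. e_fun (x n))
    \<le> A3 \<eta> h * h powr (1/2) * real N * lam powr (1/6) + B3 \<eta> * real N powr (1/2) * lam powr (- 1/6)"
proof -
  define r where "r = lam powr (1/6)"
  define u where "u = r\<^sup>2"
  define A B d S where "A = A3 \<eta> h" and "B = B3 \<eta>" and "d = (delta_tilde \<eta>)\<^sup>2"
    and "S = norm (\<Sum>n<N. e_fun (x n))"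
  define l where "l = lambda0 \<eta> h powr (1/3)"
  have r: "0 < r" using lam by (simp add: r_def)
  have u: "0 < u" using r by (simp add: u_def)
  have lam_r: "lam = u * u * u"
    using lam by (simp add: u_def r_def power2_eq_square powr_add[symmetric])
  have AB: "0 \<le> A" "0 \<le> B" using A3_nonneg B3_nonneg \<eta> h by (auto simp: A_def B_def)
  have d1: "1 \<le> d" and d2: "d * d = d + 3 * sqrt pi * (\<eta> * sqrt \<eta>) / 32"
    using delta_tilde_sq[OF \<eta>] by (auto simp: d_def)
  have Nr: "1 \<le> real N" using N by simp
  have goal: "A3 \<eta> h * h powr (1/2) * real N * lam powr (1/6) + B3 \<eta> * real N powr (1/2) * lam powr (- 1/6)
      = A * sqrt h * real N * r + B * sqrt (real N) / r"
  proof -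
    have "lam powr (- 1/6) = 1 / r" unfolding r_def by (simp add: powr_minus_divide[symmetric])
    then show ?thesis using h by (simp add: A_def B_def r_def powr_half_sqrt)
  qed
  have l_eq: "l = 1 / (1 / \<eta> + 32 * sqrt \<eta> * h / (15 * sqrt pi))"
    using lambda0_cube_root[of \<eta> h] \<eta> h by (simp add: l_def)
  have lden: "0 < 1 / \<eta> + 32 * sqrt \<eta> * h / (15 * sqrt pi)" using \<eta> h by (intro add_pos_nonneg) auto
  have l0: "0 < l" using lden by (simp add: l_eq)
  have SN: "S \<le> real N" using norm_sum_e_fun_le_card[of x "{..<N}"] by (simp add: S_def)
  have nonneg: "0 \<le> A * sqrt h * real N * r" "0 \<le> B * sqrt (real N) / r" using AB r h by auto
  have "S \<le> A * sqrt h * real N * r + B * sqrt (real N) / r"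
  \<comment> \<open>Either condition makes a single term of the bound at least N: the first the
    A-term, the second the B-term.\<close>
  proof (cases "l \<le> u \<or> real N * u \<le> B\<^sup>2")
    case True
    then show ?thesis
    proof
      assume "l \<le> u"
      then have "1 \<le> (1 / \<eta> + 32 * sqrt \<eta> * h / (15 * sqrt pi)) * u"
        using lden by (simp add: l_eq pos_divide_le_eq mult.commute)
      also have "\<dots> = 1 * (1 / (\<eta> * h) + 32 / (15 * sqrt pi) * sqrt \<eta>) * (h * u)"
        using h \<eta> by (simp add: field_simps)
      also have "\<dots> \<le> d * (1 / (\<eta> * h) + 32 / (15 * sqrt pi) * sqrt \<eta>) * (h * u)"
        using d1 h \<eta> u by (intro mult_right_mono add_nonneg_nonneg) auto
      also have "\<dots> \<le> A\<^sup>2 * (h * u)"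
        using A3_sq_ge[of \<eta> h] h \<eta> u unfolding A_def d_def by (intro mult_right_mono) auto
      also have "\<dots> = (A * sqrt h * r)\<^sup>2" using h by (simp add: power_mult_distrib u_def)
      finally have "1\<^sup>2 \<le> (A * sqrt h * r)\<^sup>2" by simp
      then have "1 \<le> A * sqrt h * r" by (rule power2_le_imp_le) (use AB r h in auto)
      then have "real N * 1 \<le> real N * (A * sqrt h * r)" by (intro mult_left_mono) auto
      then have "real N \<le> A * sqrt h * real N * r" by (simp add: mult_ac)
      then show ?thesis using SN nonneg by linarith
    next
      assume "real N * u \<le> B\<^sup>2"
      then have "(sqrt (real N) * r)\<^sup>2 \<le> B\<^sup>2" by (simp add: power_mult_distrib u_def)
      then have "sqrt (real N) * r \<le> B" using AB(2) by (rule power2_le_imp_le)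
      then have "sqrt (real N) * (sqrt (real N) * r) \<le> sqrt (real N) * B" by (intro mult_left_mono) auto
      then have "real N * r \<le> B * sqrt (real N)" by (simp add: mult.assoc[symmetric]) (simp add: mult.commute)
      then have "real N \<le> B * sqrt (real N) / r" using r by (simp add: field_simps)
      then show ?thesis using SN nonneg by linarith
    qed
  next
    case False
    then have ul: "u < l" and NB: "B\<^sup>2 < real N * u" by auto
    define M where "M = nat \<lceil>\<eta> / u\<rceil>"
    have M0: "0 < M" using \<eta> u by (simp add: M_def)
    have M1: "\<eta> / u \<le> real M" and M2: "real M - 1 \<le> \<eta> / u"
  proof -
    have "real M = of_int \<lceil>\<eta> / u\<rceil>" using \<eta> u by (simp add: M_def)
    then show "\<eta> / u \<le> real M" "real M - 1 \<le> \<eta> / u" by linarith+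
  qed
    have Mr: "1 \<le> real M" using M0 by simp
    \<comment> \<open>Rounding up costs at most one u < l, hence the sums of \<open>\<eta>\<close>
      and the cube root of \<open>lambda0\<close> in \<open>A3\<close>. The extra factor l in its
      last term comes from lam M = u^2 (M u), with one u bounded by l.\<close>
    have Mu: "real M * u \<le> \<eta> + l"
    proof -
      have "(real M - 1) * u \<le> \<eta>" using M2 u by (simp add: field_simps)
      then show ?thesis using ul by (simp add: algebra_simps)
    qed
    have Mu': "\<eta> \<le> real M * u" using M1 u by (simp add: field_simps)
    define c where "c = 4 / sqrt pi"
    have c0: "0 < c" by (simp add: c_def)
    have T: "norm (\<Sum>n<N - m. e_fun (x (n + m) - x n))
        \<le> c * real N * h * (u * r) * real m powr (1/2) + real N * h * lam * real m powr 1
           + c / (u * r) * real m powr (- (1/2)) + 2 * real m powr 0" if m: "1 \<le> m" for m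
    proof -
      have "norm (\<Sum>n<N - m. e_fun (x (n + m) - x n))
          \<le> (real (N - m) * h * (real m * lam) + 1) * (4 / sqrt (pi * (real m * lam)) + 1) + 1"
      proof (rule second_fdiff_test)
        show "fdiff_between 2 (N - m) (real m * lam) (h * (real m * lam)) (\<lambda>n. x (n + m) - x n)"
          using fdiff_between_shift_diff[of 2 N lam "h * lam" x m] dif by (simp add: mult_ac numeral_3_eq_3)
      qed (use m lam h in auto)
      also have "\<dots> \<le> (real N * h * (real m * lam) + 1) * (4 / sqrt (pi * (real m * lam)) + 1) + 1"
        using m lam h by (intro add_mono mult_mono) auto
      also have "4 / sqrt (pi * (real m * lam)) = c / (u * r) / sqrt (real m)"
      proof -
        have "lam = (u * r)\<^sup>2" by (simp add: lam_r u_def power2_eq_square)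
        then have "sqrt lam = u * r" using u r by simp
        then show ?thesis by (simp add: real_sqrt_mult c_def)
      qed
      also have "(real N * h * (real m * lam) + 1) * (c / (u * r) / sqrt (real m) + 1) + 1
        = c * real N * h * (lam / (u * r)) * (real m / sqrt (real m)) + real N * h * lam * real m + c / (u * r) / sqrt (real m) + 2"
        by (simp add: algebra_simps)
      also have "real m / sqrt (real m) = sqrt (real m)" by (simp add: real_div_sqrt)
      also have "lam / (u * r) = u * r" using u r by (simp add: lam_r u_def power2_eq_square)
      finally show ?thesis using m by (simp add: powr_half_sqrt powr_minus_divide)
    qed
    define W where "W m = 1 - real m / real M" for m
    have W0: "0 \<le> W m" if "m \<in> {1..<M}" for m using that by (simp add: W_def)
    have "(\<Sum>m=1..<M. W m * norm (\<Sum>n<N - m. e_fun (x (n + m) - x n)))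
        \<le> (\<Sum>m=1..<M. W m * (c * real N * h * (u * r) * real m powr (1/2) + real N * h * lam * real m powr 1
           + c / (u * r) * real m powr (- (1/2)) + 2 * real m powr 0))"
      using T W0 by (intro sum_mono mult_left_mono) auto
    also have "\<dots> = c * real N * h * (u * r) * (\<Sum>m=1..<M. W m * real m powr (1/2))
        + real N * h * lam * (\<Sum>m=1..<M. W m * real m powr 1)
        + c / (u * r) * (\<Sum>m=1..<M. W m * real m powr (- (1/2)))
        + 2 * (\<Sum>m=1..<M. W m * real m powr 0)"
      unfolding sum_distrib_left sum.distrib[symmetric] by (intro sum.cong refl) (simp add: algebra_simps)
    \<comment> \<open>4/15, 1/6, 4/3 and 1/2 are 1/((1 + alpha)(2 + alpha)) for alpha = 1/2, 1, -1/2
      and 0.\<close>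
    also have "\<dots> \<le> c * real N * h * (u * r) * (4/15 * (real M * sqrt (real M)))
        + real N * h * lam * (real M * real M / 6)
        + c / (u * r) * (4/3 * sqrt (real M))
        + 2 * (real M / 2)"
    proof (intro add_mono mult_left_mono)
      have "real M powr (3/2) = real M * sqrt (real M)"
        using powr_add[of "real M" 1 "1/2"] M0 by (simp add: powr_half_sqrt)
      then show "(\<Sum>m=1..<M. W m * real m powr (1/2)) \<le> 4/15 * (real M * sqrt (real M))"
        using sum_weighted_powr_le[of "1/2" M] M0 unfolding W_def by simp
      show "(\<Sum>m=1..<M. W m * real m powr 1) \<le> real M * real M / 6"
        using sum_weighted_powr_le[of 1 M] M0 unfolding W_def by (simp add: power2_eq_square)
      show "(\<Sum>m=1..<M. W m * real m powr - (1/2)) \<le> 4/3 * sqrt (real M)"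
        using sum_weighted_powr_neg_le[of "1/2" M] M0 unfolding W_def by (simp add: powr_half_sqrt)
      show "(\<Sum>m=1..<M. W m * real m powr 0) \<le> real M / 2"
        using sum_weighted_powr_le[of 0 M] M0 unfolding W_def by simp
    qed (use c0 h u r lam in auto)
    finally have sumT: "(\<Sum>m=1..<M. W m * norm (\<Sum>n<N - m. e_fun (x (n + m) - x n))) \<le> \<dots>" .
    \<comment> \<open>M - 1 is at most \<open>\<eta>\<close>/u = (d - 1) B^2/u, and B^2 < N u in the
      present case.\<close>
    have q: "real (N + M - 1) \<le> d * real N"
    proof -
      have "d * d - d = 3 * sqrt pi * (\<eta> * sqrt \<eta>) / 32" using d2 by simp
      then have "\<eta> = (d * d - d) * (32 / (3 * sqrt pi * sqrt \<eta>))" using \<eta> by simp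
      also have "\<dots> = (d - 1) * B\<^sup>2" using B3_sq[OF \<eta>] by (simp add: B_def d_def algebra_simps)
      also have "\<dots> \<le> (d - 1) * (real N * u)" using NB d1 by (intro mult_left_mono) auto
      finally have "\<eta> / u \<le> (d - 1) * real N" using u by (simp add: field_simps)
      then have "real M - 1 \<le> (d - 1) * real N" using M2 by linarith
      then show ?thesis using N M0 by (simp add: algebra_simps of_nat_diff)
    qed
    have "S\<^sup>2 \<le> real (N + M - 1) / real M *
       (real N + 2 * (\<Sum>m=1..<M. W m * norm (\<Sum>n<N - m. e_fun (x (n + m) - x n))))"
      using weyl_van_der_corput[OF M0, of x N] by (simp add: S_def W_def)
    also have "\<dots> \<le> d * real N / real M * (real N + 2 * (c * real N * h * (u * r) * (4/15 * (real M * sqrt (real M)))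
        + real N * h * lam * (real M * real M / 6) + c / (u * r) * (4/3 * sqrt (real M)) + 2 * (real M / 2)))"
      using q sumT d1 W0 by (intro mult_mono divide_right_mono add_mono mult_left_mono add_nonneg_nonneg mult_nonneg_nonneg sum_nonneg) auto
    also have "\<dots> = d * ((real N)\<^sup>2 * (1 / real M) + 8 / 15 * c * (real N)\<^sup>2 * h * (u * r) * sqrt (real M)
        + (real N)\<^sup>2 * h * lam * real M / 3 + 8 / 3 * c * real N / (u * r) * (sqrt (real M) / real M) + 2 * real N)"
      using Mr u r by (simp add: field_simps power2_eq_square)
    also have "\<dots> \<le> d * ((real N)\<^sup>2 * (u / \<eta>) + 8 / 15 * c * (real N)\<^sup>2 * h * (u * r) * (sqrt (\<eta> + l) / r)
        + (real N)\<^sup>2 * h * (u * l * (\<eta> + l)) / 3 + 8 / 3 * c * real N / (u * r) * (r / sqrt \<eta>) + 2 * real N)"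
    proof -
      have r1: "1 / real M \<le> u / \<eta>" using Mu' Mr \<eta> by (simp add: field_simps)
      have "sqrt (real M * u) \<le> sqrt (\<eta> + l)" using Mu by simp
      then have r2: "sqrt (real M) \<le> sqrt (\<eta> + l) / r" using r by (simp add: u_def real_sqrt_mult field_simps)
      have "sqrt \<eta> \<le> sqrt (real M * u)" using Mu' by simp
      then have "sqrt \<eta> \<le> sqrt (real M) * r" using r by (simp add: u_def real_sqrt_mult)
      then have r3: "sqrt (real M) / real M \<le> r / sqrt \<eta>"
        using Mr \<eta> by (simp add: sqrt_divide_self_eq field_simps)
      have "(u * u) * (real M * u) \<le> (u * l) * (\<eta> + l)"
        using Mu ul u l0 \<eta> by (intro mult_mono) auto
      then have r4: "lam * real M \<le> u * l * (\<eta> + l)" by (simp add: lam_r mult_ac)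
      have "h * (lam * real M) \<le> h * (u * l * (\<eta> + l))" using r4 h by (intro mult_left_mono) auto
      then have r5: "(real N)\<^sup>2 * h * lam * real M / 3 \<le> (real N)\<^sup>2 * h * (u * l * (\<eta> + l)) / 3"
        by (simp add: mult.assoc mult_left_mono)
      show ?thesis
        using d1 c0 h u r by (intro mult_left_mono add_mono r1 r2 r3 r5) auto
    qed
    also have "\<dots> = d * (1 / (\<eta> * h) + 32 / (15 * sqrt pi) * sqrt (\<eta> + l) + 1/3 * (\<eta> + l) * l) * (h * (real N)\<^sup>2 * u)
        + 32 / (3 * sqrt pi * sqrt \<eta>) * d * (real N / u) + 2 * d * real N"
      using u r \<eta> h by (simp add: c_def field_simps)
    also have "\<dots> = (A * sqrt h * real N * r)\<^sup>2 + (B * sqrt (real N) / r)\<^sup>2 + 2 * d * real N"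
      using A3_sq[of \<eta> h, folded l_def d_def] B3_sq[OF \<eta>, folded d_def] \<eta> h
      by (simp add: A_def B_def power_mult_distrib power_divide u_def)
    \<comment> \<open>The additive constants of the second difference test are absorbed by the cross term.\<close>
    also have "2 * d * real N \<le> 2 * (A * sqrt h * real N * r) * (B * sqrt (real N) / r)"
    proof -
      have "d * 1 * (real N * 1) \<le> (A * B) * sqrt h * (real N * sqrt (real N))"
        using A3_B3_ge[of \<eta> h] \<eta> h d1 Nr AB
        by (intro mult_mono) (auto simp: A_def B_def d_def)
      then show ?thesis using r by (simp add: mult_ac)
    qed
    finally have "S\<^sup>2 \<le> (A * sqrt h * real N * r + B * sqrt (real N) / r)\<^sup>2"
      unfolding power2_sum by (simp only: add_left_mono)
    then show ?thesis by (rule power2_le_imp_le) (use nonneg in auto)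
  qed
  then show ?thesis unfolding goal S_def .
qed


subsection \<open>The inductive step\<close>

text \<open>In the nontrivial case $P + Q < N$ for the two terms $P, Q$ of the bound, hence $4PQ < N^2$. As the
powers of $\lambda$ cancel in $PQ$, this is a lower bound for $N$ alone; it is where the constant 2337
is used. For $J = 4$ it only suffices because of the factor $b = 72/55$.\<close>

lemma weyl_step:
  fixes x :: "nat \<Rightarrow> real" and J A B d h lam :: real and N :: nat
  defines "A' \<equiv> d * (h powr (- 1 / J) + 2 powr (19/12) * (J - 1) / sqrt ((2 * J - 1) * (4 * J - 3)) * A powr (1/2))"
    and "B' \<equiv> d * (2 powr (3/2) * (J - 1) / sqrt ((2 * J - 3) * (4 * J - 5))) * B powr (1/2)"
  assumes J: "J = 4 \<or> 8 \<le> J" and h: "1 \<le> h" and A: "0 \<le> A" and B: "1 \<le> B" and d: "1 \<le> d"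
    and d_ge: "2 / (2337 powr (1 - 2 / J) * B) \<le> d\<^sup>2 - 1" and lam: "0 < lam" and N: "0 < N"
    and T: "\<And>m. 1 \<le> m \<Longrightarrow> norm (\<Sum>n<N - m. e_fun (x (n + m) - x n))
      \<le> A * h powr (2 / J) * real N * (real m * lam) powr (1 / (2 * J - 2))
         + B * real N powr (1 - 2 / J) * (real m * lam) powr (- 1 / (2 * J - 2))"
  shows "norm (\<Sum>n<N. e_fun (x n))
    \<le> A' * h powr (1 / J) * real N * lam powr (1 / (4 * J - 2))
       + B' * real N powr (1 - 1 / J) * lam powr (- 1 / (4 * J - 2))"
proof -
  define S where "S = norm (\<Sum>n<N. e_fun (x n))"
  define H where "H = h powr (1 / J)"
  define Y where "Y = real N powr (1 - 1 / J)"
  define r where "r = lam powr (1 / (4 * J - 2))"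
  \<comment> \<open>With \<open>\<alpha>\<close> = 1/(2J - 2), a = 2/((1 +
    \<open>\<alpha>\<close>)(2 + \<open>\<alpha>\<close>)) and b = 2/((1 -
    \<open>\<alpha>\<close>)(2 - \<open>\<alpha>\<close>)).\<close>
  define a where "a = 8 * (J - 1)\<^sup>2 / ((2 * J - 1) * (4 * J - 3))"
  define b where "b = 8 * (J - 1)\<^sup>2 / ((2 * J - 3) * (4 * J - 5))"
  define \<alpha> where "\<alpha> = 1 / (2 * J - 2)"
  have J4: "4 \<le> J" using J by auto
  have H: "1 \<le> H" using h J4 by (simp add: H_def ge_one_powr_ge_zero)
  have Y: "0 < Y" using N by (simp add: Y_def)
  have r: "0 < r" using lam by (simp add: r_def)
  have Nr: "1 \<le> real N" using N by simp
  have a0: "0 \<le> a" using J4 by (simp add: a_def)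
  have b1: "1 \<le> b"
  proof -
    have "(2 * J - 3) * (4 * J - 5) \<le> 8 * (J - 1)\<^sup>2" using J4 by (simp add: power2_eq_square algebra_simps)
    moreover have "0 < (2 * J - 3) * (4 * J - 5)" using J4 by (intro mult_pos_pos) auto
    ultimately show ?thesis by (simp add: b_def)
  qed
  have two: "(2::real) powr (3/2) = sqrt 8"
  proof -
    have "(2::real) powr (3/2) = 2 * sqrt 2" using powr_add[of "2::real" 1 "1/2"] by (simp add: powr_half_sqrt)
    also have "\<dots> = sqrt (4 * 2)" by (simp only: real_sqrt_mult real_sqrt_four)
    finally show ?thesis by simp
  qed
  have sq: "sqrt (8 * (J - 1)\<^sup>2 / z) = sqrt 8 * (J - 1) / sqrt z" for z
    using J4 by (simp add: real_sqrt_mult real_sqrt_divide)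
  \<comment> \<open>19/12 = 1/12 + 3/2: sqrt 8 belongs to sqrt a, and 2^(1/12) is the square root of
    the rounding loss in \<open>v_hi\<close>.\<close>
  have A': "A' * H = d * (1 + 2 powr (1/12) * sqrt (a * A) * H)"
  proof -
    have "h powr (- 1 / J) = 1 / H" unfolding H_def by (simp add: powr_minus_divide[symmetric])
    moreover have "(2::real) powr (19/12) = 2 powr (1/12) * sqrt 8"
      using powr_add[of "2::real" "1/12" "3/2"] by (simp add: two)
    moreover have "sqrt (a * A) = sqrt 8 * (J - 1) / sqrt ((2 * J - 1) * (4 * J - 3)) * A powr (1/2)"
      unfolding a_def real_sqrt_mult[of _ A] sq powr_half_sqrt[OF A] ..
    ultimately have "A' = d * (1 / H + 2 powr (1/12) * sqrt (a * A))"
      unfolding A'_def by (simp only: times_divide_eq_left times_divide_eq_right mult.assoc)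
    then show ?thesis using H by (simp add: algebra_simps)
  qed
  have B': "B' = d * sqrt (b * B)"
  proof -
    have "sqrt (b * B) = sqrt 8 * (J - 1) / sqrt ((2 * J - 3) * (4 * J - 5)) * B powr (1/2)"
      unfolding b_def real_sqrt_mult[of _ B] sq using B by (simp only: powr_half_sqrt)
    then show ?thesis unfolding B'_def two by (simp only: mult.assoc)
  qed
  have AH1: "1 \<le> A' * H"
  proof -
    have "d * 1 \<le> A' * H" unfolding A' using d a0 A H by (intro mult_left_mono) auto
    then show ?thesis using d by simp
  qed
  have bB: "1 \<le> b * B" using mult_mono[OF b1 B] b1 by simp
  have B'sq: "b * B \<le> B'\<^sup>2" 
  proof -
    have "1 * (b * B) \<le> d\<^sup>2 * (b * B)" using d bB by (intro mult_right_mono) auto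
    also have "\<dots> = B'\<^sup>2" using bB by (simp add: B' power_mult_distrib)
    finally show ?thesis by simp
  qed
  have B'1: "1 \<le> B'" 
  proof -
    have "1 * 1 \<le> d * sqrt (b * B)" using d bB by (intro mult_mono) auto
    then show ?thesis by (simp add: B')
  qed
  define P Q where "P = A' * H * real N * r" and "Q = B' * Y / r"
  have goal: "A' * h powr (1 / J) * real N * lam powr (1 / (4 * J - 2))
       + B' * real N powr (1 - 1 / J) * lam powr (- 1 / (4 * J - 2)) = P + Q"
  proof -
    have "lam powr (- 1 / (4 * J - 2)) = 1 / r" unfolding r_def by (simp add: powr_minus_divide[symmetric])
    then show ?thesis by (simp add: P_def Q_def H_def Y_def r_def)
  qed
  have PQ0: "0 \<le> P" "0 \<le> Q" using AH1 B'1 r Y by (auto simp: P_def Q_def)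
  have SN: "S \<le> real N" using norm_sum_e_fun_le_card[of x "{..<N}"] by (simp add: S_def)
  have "S \<le> P + Q"
  proof (cases "real N \<le> P + Q")
    case True
    then show ?thesis using SN by simp
  next
    case False
    define q where "q = r\<^sup>2"
    have q0: "0 < q" using r by (simp add: q_def)
    have q_eq: "q = lam powr (1 / (2 * J - 1))"
    proof -
      have "q = lam powr (1 / (4 * J - 2) + 1 / (4 * J - 2))"
        by (simp only: q_def r_def power2_eq_square powr_add)
      also have "1 / (4 * J - 2) + 1 / (4 * J - 2) = 1 / (2 * J - 1)" using J4 by (simp add: field_simps)
      finally show ?thesis .
    qed
    have "r < 1"
    proof (rule ccontr)
      assume "\<not> r < 1"
      then have "1 * (real N * 1) \<le> A' * H * (real N * r)" using AH1 by (intro mult_mono) auto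
      then have "real N \<le> P" by (simp add: P_def mult.assoc)
      then show False using False PQ0 by linarith
    qed
    then have q1: "q < 1" using r by (simp add: q_def power_less_one_iff)
    have N1: "real N powr (1 / J) = real N / Y"
      using N by (simp add: Y_def powr_diff)
    have N2: "real N powr (1 - 2 / J) = Y\<^sup>2 / real N"
    proof -
      have "Y\<^sup>2 = real N powr ((1 - 1 / J) + (1 - 1 / J))"
        by (simp only: Y_def power2_eq_square powr_add)
      also have "(1 - 1 / J) + (1 - 1 / J) = (1 - 2 / J) + 1" by (simp add: field_simps)
      also have "real N powr ((1 - 2 / J) + 1) = real N powr (1 - 2 / J) * real N"
        using N by (subst powr_add) simp
      finally show ?thesis using N by simp
    qed
    have N4: "4 * B' < real N powr (1 / J)"
    proof -
      have "4 * (P * Q) \<le> (P + Q)\<^sup>2" 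
        using zero_le_power2[of "P - Q"] by (simp add: power2_eq_square algebra_simps)
      also have "\<dots> < (real N)\<^sup>2" using False PQ0 by (intro power_strict_mono) auto
      also have "P * Q = (A' * H) * (B' * real N * Y)" using r by (simp add: P_def Q_def)
      finally have "(A' * H) * (4 * B' * real N * Y) < real N * real N" by (simp add: power2_eq_square mult_ac)
      moreover have "1 * (4 * B' * real N * Y) \<le> (A' * H) * (4 * B' * real N * Y)"
        using AH1 B'1 Y by (intro mult_right_mono) auto
      ultimately have "real N * (4 * B' * Y) < real N * real N" by (simp add: mult_ac)
      then have "4 * B' * Y < real N" using N by simp
      then show ?thesis using Y by (simp add: N1 field_simps)
    qed
    \<comment> \<open>With n = N^(1/J) > 4 B' the power of N is n^(J - 2). For J >= 8 it is at least
      4^6 = 4096. For J = 4 it is at least 16 b, and 32 b^2 is about 54.8, while sqrt 2337 <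
      49.\<close>
    have big: "2337 powr (1 - 2 / J) \<le> 2 * b * real N powr (1 - 2 / J)"
    proof -
      have e: "real N powr (1 - 2 / J) = (real N powr (1 / J)) powr (J - 2)"
        using J4 by (simp add: powr_powr diff_divide_distrib)
      show ?thesis
      proof (cases "J = 4")
        case True
        have "16 * b \<le> 16 * (b * B)" using mult_left_mono[OF B, of b] b1 by simp
        also have "\<dots> \<le> (4 * B')\<^sup>2" using B'sq by (simp add: power_mult_distrib)
        also have "\<dots> \<le> (real N powr (1 / J))\<^sup>2" using N4 B'1 by (intro power_mono) auto
        also have "\<dots> = real N powr (1 - 2 / J)" unfolding e using True N by simp
        finally have "2 * b * (16 * b) \<le> 2 * b * real N powr (1 - 2 / J)" using b1 by (intro mult_left_mono) auto
        moreover have "2 * b * (16 * b) = 165888 / 3025" by (simp add: b_def True power2_eq_square)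
        moreover have "2337 powr (1 - 2 / J) \<le> (49::real)"
        proof -
          have "2337 powr (1 - 2 / J) = sqrt 2337" by (simp add: True powr_half_sqrt)
          also have "\<dots> \<le> 49" by (rule real_le_lsqrt) auto
          finally show ?thesis .
        qed
        ultimately show ?thesis by simp
      next
        case False
        then have J8: "8 \<le> J" using J by simp
        have "2337 powr (1 - 2 / J) \<le> 2337 powr (1::real)" using J4 by (intro powr_mono) auto
        also have "\<dots> \<le> (4::real) powr 6" by simp
        also have "\<dots> \<le> 4 powr (J - 2)" using J8 by (intro powr_mono) auto
        also have "\<dots> \<le> (real N powr (1 / J)) powr (J - 2)"
          using N4 B'1 J8 by (intro powr_mono2) auto
        also have "\<dots> = 1 * real N powr (1 - 2 / J)" by (simp only: e mult_1_left)
        also have "\<dots> \<le> 2 * b * real N powr (1 - 2 / J)" using b1 by (intro mult_right_mono) auto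
        finally show ?thesis .
      qed
    qed
    define M where "M = nat \<lceil>1 / q\<rceil>"
    have M0: "0 < M" using q0 by (simp add: M_def)
    have M1: "1 / q \<le> real M" and M2: "real M - 1 \<le> 1 / q"
    proof -
      have "real M = of_int \<lceil>1 / q\<rceil>" using q0 by (simp add: M_def)
      then show "1 / q \<le> real M" "real M - 1 \<le> 1 / q" by linarith+
    qed
    have Mr: "1 \<le> real M" using M0 by simp
    \<comment> \<open>Rounding at most doubles 1/q. As M enters the A-term only through its power
      \<open>\<alpha>\<close> <= 1/6, the loss is at most 2^(1/6).\<close>
    have M3: "real M \<le> 2 / q"
    proof -
      have "1 \<le> 1 / q" using q0 q1 by simp
      then show ?thesis using M2 by simp
    qed
    \<comment> \<open>Q < N bounds 1/q by N/(b B N^(1 - 2/J)); \<open>big\<close> and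
      \<open>d_ge\<close> turn this into (d^2 - 1) N.\<close>
    have ratio: "real (N + M - 1) \<le> d\<^sup>2 * real N"
    proof -
      have "B' * Y < real N * r"
      proof -
        have "Q < real N" using False PQ0 by linarith
        then show ?thesis using r by (simp add: Q_def field_simps)
      qed
      then have "(B' * Y)\<^sup>2 \<le> (real N * r)\<^sup>2" using B'1 Y by (intro power_mono) auto
      then have "B'\<^sup>2 * Y\<^sup>2 \<le> (real N)\<^sup>2 * q" by (simp add: power_mult_distrib q_def)
      moreover have "b * B * Y\<^sup>2 \<le> B'\<^sup>2 * Y\<^sup>2" using B'sq by (intro mult_right_mono) auto
      ultimately have "b * B * Y\<^sup>2 \<le> (real N)\<^sup>2 * q" by linarith
      then have q_inv: "1 / q \<le> (real N)\<^sup>2 / (b * B * Y\<^sup>2)"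
      proof -
        define z where "z = b * B * Y\<^sup>2"
        have "0 < z" using bB Y by (simp add: z_def)
        then show ?thesis
          using \<open>b * B * Y\<^sup>2 \<le> (real N)\<^sup>2 * q\<close> q0 unfolding z_def[symmetric] by (simp add: field_simps)
      qed
      have "(real N)\<^sup>2 / (b * B * Y\<^sup>2) = real N * (1 / (b * real N powr (1 - 2 / J) * B))"
        using N Y by (simp add: N2 field_simps power2_eq_square)
      also have "\<dots> \<le> real N * (2 / (2337 powr (1 - 2 / J) * B))"
      proof -
        have "2 / (2 * b * real N powr (1 - 2 / J) * B) \<le> 2 / (2337 powr (1 - 2 / J) * B)"
          using big B by (intro divide_left_mono mult_right_mono mult_pos_pos) (use b1 N in auto)
        then show ?thesis by (intro mult_left_mono) auto
      qed
      also have "\<dots> \<le> real N * (d\<^sup>2 - 1)" using d_ge by (intro mult_left_mono) auto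
      finally have "real M - 1 \<le> real N * (d\<^sup>2 - 1)" using M2 q_inv by linarith
      then show ?thesis using N M0 by (simp add: algebra_simps of_nat_diff)
    qed
    have \<alpha>: "0 < \<alpha>" "\<alpha> \<le> 1/6" using J4 by (auto simp: \<alpha>_def field_simps)
    define W where "W m = 1 - real m / real M" for m
    define s where "s = lam powr \<alpha>"
    have s0: "0 < s" using lam by (simp add: s_def)
    have W0: "0 \<le> W m" if "m \<in> {1..<M}" for m using that by (simp add: W_def)
    have T': "norm (\<Sum>n<N - m. e_fun (x (n + m) - x n))
        \<le> A * H\<^sup>2 * real N * s * real m powr \<alpha> + B * (Y\<^sup>2 / real N) / s * real m powr (- \<alpha>)" if "1 \<le> m" for m
    proof -
      have "H\<^sup>2 = h powr (2 / J)" by (simp add: H_def power2_eq_square powr_add[symmetric])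
      moreover have "(real m * lam) powr (1 / (2 * J - 2)) = s * real m powr \<alpha>"
        by (simp add: s_def \<alpha>_def powr_mult)
      moreover have "(real m * lam) powr (- 1 / (2 * J - 2)) = 1 / s * real m powr (- \<alpha>)"
      proof -
        have "- 1 / (2 * J - 2) = - \<alpha>" by (simp add: \<alpha>_def)
        then have "(real m * lam) powr (- 1 / (2 * J - 2)) = real m powr (- \<alpha>) * lam powr (- \<alpha>)"
          by (simp only: powr_mult)
        also have "lam powr (- \<alpha>) = 1 / s" by (simp add: s_def powr_minus_divide)
        finally show ?thesis by simp
      qed
      ultimately show ?thesis using T[OF that] unfolding N2 by (simp add: mult_ac)
    qed
    have "(\<Sum>m=1..<M. W m * norm (\<Sum>n<N - m. e_fun (x (n + m) - x n)))
        \<le> (\<Sum>m=1..<M. W m * (A * H\<^sup>2 * real N * s * real m powr \<alpha> + B * (Y\<^sup>2 / real N) / s * real m powr (- \<alpha>)))"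
      using T' W0 by (intro sum_mono mult_left_mono) auto
    also have "\<dots> = A * H\<^sup>2 * real N * s * (\<Sum>m=1..<M. W m * real m powr \<alpha>)
        + B * (Y\<^sup>2 / real N) / s * (\<Sum>m=1..<M. W m * real m powr (- \<alpha>))"
      unfolding sum_distrib_left sum.distrib[symmetric] by (intro sum.cong refl) (simp add: algebra_simps)
    also have "\<dots> \<le> A * H\<^sup>2 * real N * s * (a / 2 * (real M * real M powr \<alpha>))
        + B * (Y\<^sup>2 / real N) / s * (b / 2 * (real M / real M powr \<alpha>))"
    proof (intro add_mono mult_left_mono)
      have frac: "1 / ((p / (2 * w)) * (t / (2 * w))) = 8 * w\<^sup>2 / (p * t) / 2" for p t w :: real
        by (simp add: power2_eq_square)
      have eqA: "real M powr (1 + \<alpha>) / ((1 + \<alpha>) * (2 + \<alpha>)) = a / 2 * (real M * real M powr \<alpha>)"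
      proof -
        have "1 + \<alpha> = (2 * J - 1) / (2 * (J - 1))" "2 + \<alpha> = (4 * J - 3) / (2 * (J - 1))"
          using J4 by (auto simp: \<alpha>_def field_simps)
        then have "1 / ((1 + \<alpha>) * (2 + \<alpha>)) = a / 2" by (simp only: frac a_def)
        moreover have "real M powr (1 + \<alpha>) = real M * real M powr \<alpha>" using M0 by (simp add: powr_add)
        ultimately show ?thesis by (metis mult.commute times_divide_eq_right mult_1_right)
      qed
      have "(\<Sum>m=1..<M. W m * real m powr \<alpha>) \<le> real M powr (1 + \<alpha>) / ((1 + \<alpha>) * (2 + \<alpha>))"
        unfolding W_def by (rule sum_weighted_powr_le) (use \<alpha> M0 in auto)
      then show "(\<Sum>m=1..<M. W m * real m powr \<alpha>) \<le> a / 2 * (real M * real M powr \<alpha>)"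
        by (simp only: eqA)
      have "real M powr (1 - \<alpha>) / ((1 - \<alpha>) * (2 - \<alpha>)) = b / 2 * (real M / real M powr \<alpha>)"
      proof -
        have "1 - \<alpha> = (2 * J - 3) / (2 * (J - 1))" "2 - \<alpha> = (4 * J - 5) / (2 * (J - 1))"
          using J4 by (auto simp: \<alpha>_def field_simps)
        then have "1 / ((1 - \<alpha>) * (2 - \<alpha>)) = b / 2" by (simp only: frac b_def)
        moreover have "real M powr (1 - \<alpha>) = real M / real M powr \<alpha>" using M0 by (simp add: powr_diff)
        ultimately show ?thesis by (metis mult.commute times_divide_eq_right mult_1_right)
      qed
      then show "(\<Sum>m=1..<M. W m * real m powr (- \<alpha>)) \<le> b / 2 * (real M / real M powr \<alpha>)"
        using sum_weighted_powr_neg_le[of \<alpha> M] \<alpha> M0 by (simp add: W_def)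
    qed (use A H s0 B Y in auto)
    finally have sumT: "(\<Sum>m=1..<M. W m * norm (\<Sum>n<N - m. e_fun (x (n + m) - x n))) \<le> \<dots>" .
    define v where "v = s * real M powr \<alpha>"
    have v0: "0 < v" using s0 M0 by (simp add: v_def)
    have v_eq: "v = (lam * real M) powr \<alpha>" by (simp add: v_def s_def powr_mult)
    \<comment> \<open>This identity fixes the shift length 1/q: the diagonal term 1/M and the A-term
      then have the same order q.\<close>
    have lq: "(lam / q) powr \<alpha> = q"
    proof -
      have "lam / q = lam powr (1 - 1 / (2 * J - 1))" using lam by (simp add: q_eq powr_diff)
      also have "1 - 1 / (2 * J - 1) = (2 * J - 2) * (1 / (2 * J - 1))" using J4 by (simp add: field_simps)
      finally have "(lam / q) powr \<alpha> = lam powr ((2 * J - 2) * (1 / (2 * J - 1)) * \<alpha>)" by (simp only: powr_powr)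
      also have "(2 * J - 2) * (1 / (2 * J - 1)) * \<alpha> = 1 / (2 * J - 1)" using J4 by (simp add: \<alpha>_def)
      finally show ?thesis by (simp add: q_eq)
    qed
    have v_lo: "q \<le> v"
    proof -
      have "(lam / q) powr \<alpha> \<le> (lam * real M) powr \<alpha>"
        using M1 lam q0 \<alpha> mult_left_mono[of "1 / q" "real M" lam] by (intro powr_mono2) auto
      then show ?thesis by (simp add: lq v_eq)
    qed
    have v_hi: "v \<le> 2 powr (1/6) * q"
    proof -
      have "(lam * real M) powr \<alpha> \<le> (2 * (lam / q)) powr \<alpha>"
      proof (rule powr_mono2)
        show "lam * real M \<le> 2 * (lam / q)" using mult_left_mono[OF M3, of lam] lam by (simp add: mult_ac)
      qed (use \<alpha> lam in auto)
      also have "\<dots> = 2 powr \<alpha> * q" using lq by (simp only: powr_mult)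
      also have "\<dots> \<le> 2 powr (1/6) * q" using \<alpha> q0 by (intro mult_right_mono powr_mono) auto
      finally show ?thesis by (simp only: v_eq)
    qed
    have "S\<^sup>2 \<le> real (N + M - 1) / real M *
       (real N + 2 * (\<Sum>m=1..<M. W m * norm (\<Sum>n<N - m. e_fun (x (n + m) - x n))))"
      using weyl_van_der_corput[OF M0, of x N] by (simp add: S_def W_def)
    also have "\<dots> \<le> d\<^sup>2 * real N / real M * (real N + 2 * (A * H\<^sup>2 * real N * s * (a / 2 * (real M * real M powr \<alpha>))
        + B * (Y\<^sup>2 / real N) / s * (b / 2 * (real M / real M powr \<alpha>))))"
      using ratio sumT d W0 by (intro mult_mono divide_right_mono add_mono mult_left_mono add_nonneg_nonneg mult_nonneg_nonneg sum_nonneg) auto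
    also have "\<dots> = d\<^sup>2 * ((real N)\<^sup>2 * (1 / real M) + a * A * H\<^sup>2 * (real N)\<^sup>2 * v + b * B * Y\<^sup>2 * (1 / v))"
      using Mr s0 Nr by (simp add: v_def field_simps power2_eq_square)
    also have "\<dots> \<le> d\<^sup>2 * ((real N)\<^sup>2 * q + a * A * H\<^sup>2 * (real N)\<^sup>2 * (2 powr (1/6) * q) + b * B * Y\<^sup>2 * (1 / q))"
    proof -
      have m1: "1 / real M \<le> q" using M1 q0 Mr by (simp add: field_simps)
      have m2: "1 / v \<le> 1 / q" using v_lo q0 v0 by (simp add: frac_le)
      show ?thesis
        using a0 A bB by (intro mult_left_mono add_mono m1 m2 v_hi) auto
    qed
    also have "\<dots> = d\<^sup>2 * (1 + 2 powr (1/6) * (a * A * H\<^sup>2)) * ((real N)\<^sup>2 * q) + Q\<^sup>2"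
    proof -
      have "Q\<^sup>2 = d\<^sup>2 * (b * B * Y\<^sup>2 * (1 / q))"
        using bB by (simp add: Q_def B' power_mult_distrib power_divide q_def)
      then show ?thesis by (simp add: algebra_simps)
    qed
    \<comment> \<open>Replacing 1 + z^2 by (1 + z)^2 explains why \<open>A'\<close> is a sum of two
      terms instead of a square root.\<close>
    also have "d\<^sup>2 * (1 + 2 powr (1/6) * (a * A * H\<^sup>2)) * ((real N)\<^sup>2 * q) \<le> P\<^sup>2"
    proof -
      define z where "z = 2 powr (1/12) * sqrt (a * A) * H"
      have z0: "0 \<le> z" using a0 A H by (simp add: z_def)
      have "((2::real) powr (1/12))\<^sup>2 = 2 powr (1/6)" by (simp add: power2_eq_square powr_add[symmetric])
      then have "z\<^sup>2 = 2 powr (1/6) * (a * A * H\<^sup>2)"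
        using a0 A by (simp add: z_def power_mult_distrib)
      then have "1 + 2 powr (1/6) * (a * A * H\<^sup>2) \<le> (1 + z)\<^sup>2"
        using z0 by (simp add: power2_sum)
      then have "d\<^sup>2 * (1 + 2 powr (1/6) * (a * A * H\<^sup>2)) * ((real N)\<^sup>2 * q) \<le> d\<^sup>2 * (1 + z)\<^sup>2 * ((real N)\<^sup>2 * q)"
        using q0 by (intro mult_right_mono mult_left_mono) auto
      also have "\<dots> = P\<^sup>2" by (simp add: P_def A' z_def[symmetric] power_mult_distrib q_def)
      finally show ?thesis .
    qed
    also have "P\<^sup>2 + Q\<^sup>2 \<le> (P + Q)\<^sup>2" using PQ0 by (simp add: power2_sum)
    finally have "S\<^sup>2 \<le> (P + Q)\<^sup>2" by simp
    then show ?thesis by (rule power2_le_imp_le) (use PQ0 in auto)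
  qed
  then show ?thesis unfolding goal S_def .
qed


subsection \<open>The general case\<close>

lemma B_factor_ge_1:
  fixes J :: real
  assumes "4 \<le> J"
  shows "1 \<le> 2 powr (3/2) * (J - 1) / sqrt ((2 * J - 3) * (4 * J - 5))"
proof -
  have "(2 * J - 3) * (4 * J - 5) \<le> (2 powr (3/2) * (J - 1))\<^sup>2"
  proof -
    have "((2::real) powr (3/2))\<^sup>2 = 8" by (simp add: power2_eq_square powr_add[symmetric])
    then have "(2 powr (3/2) * (J - 1))\<^sup>2 = 8 * (J - 1)\<^sup>2" by (simp only: power_mult_distrib)
    then show ?thesis using assms by (simp add: power2_eq_square algebra_simps)
  qed
  then have "sqrt ((2 * J - 3) * (4 * J - 5)) \<le> 2 powr (3/2) * (J - 1)"
    using assms by (intro real_le_lsqrt) auto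
  moreover have "0 < (2 * J - 3) * (4 * J - 5)" using assms by (intro mult_pos_pos) auto
  ultimately show ?thesis by (simp add: pos_le_divide_eq)
qed

lemma delta_sq:
  assumes "0 < \<eta>"
  shows "(delta j \<eta>)\<^sup>2 = 1 + 2 / 2337 powr (1 - 2 / 2 ^ (j - 1)) * (9 * pi / 1024 * \<eta>) powr (1 / 2 ^ (j - 1))"
proof -
  have "0 \<le> 1 + 2 / 2337 powr (1 - 2 / 2 ^ (j - 1)) * (9 * pi / 1024 * \<eta>) powr (1 / 2 ^ (j - 1))"
    by (intro add_nonneg_nonneg) auto
  then show ?thesis unfolding delta_def Let_def by (rule real_sqrt_pow2)
qed

lemma delta_ge_1: "1 \<le> delta j \<eta>"
  by (simp add: delta_def Let_def)

lemma two_power_ge_4: "3 \<le> j \<Longrightarrow> (4::real) \<le> 2 ^ (j - 1)"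
  using power_increasing[of 2 "j - 1" "2::real"] by simp

lemma coeff_3: "A_coeff 3 \<eta> h = A3 \<eta> h" "B_coeff 3 \<eta> = B3 \<eta>"
  by (simp_all add: numeral_3_eq_3)

lemma A_coeff_nonneg: "0 < \<eta> \<Longrightarrow> 0 < h \<Longrightarrow> 0 \<le> A_coeff j \<eta> h"
proof (induction j)
  case (Suc j)
  show ?case
  proof (cases "j < 3")
    case False
    then have J: "(4::real) \<le> 2 ^ (j - 1)" by (intro two_power_ge_4) simp
    have "0 \<le> delta j \<eta>" using delta_ge_1[of j \<eta>] by linarith
    then show ?thesis
      using False J unfolding A_coeff.simps Let_def
      by (auto intro!: mult_nonneg_nonneg add_nonneg_nonneg divide_nonneg_nonneg real_sqrt_ge_zero)
  qed (use Suc A3_nonneg in simp)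
qed (simp add: A3_nonneg)

lemma B_coeff_Suc_ge:
  assumes "3 \<le> j"
  shows "B_coeff j \<eta> powr (1/2) \<le> B_coeff (Suc j) \<eta>"
proof -
  define J :: real where "J = 2 ^ (j - 1)"
  define c where "c = 2 powr (3/2) * (J - 1) / sqrt ((2 * J - 3) * (4 * J - 5))"
  have c: "1 \<le> c" unfolding c_def using two_power_ge_4[OF assms] by (intro B_factor_ge_1) (simp add: J_def)
  have "1 * 1 \<le> delta j \<eta> * c" using c delta_ge_1[of j \<eta>] by (intro mult_mono) auto
  then have "1 * B_coeff j \<eta> powr (1/2) \<le> delta j \<eta> * c * B_coeff j \<eta> powr (1/2)"
    by (intro mult_right_mono) auto
  then show ?thesis using assms by (simp add: Let_def c_def J_def)
qed

text \<open>The second bound turns the hypothesis of \<open>weyl_step\<close> with 1/B into the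
  explicit \<open>delta j\<close>. Both survive the recursion, since the square root of B matches
  the doubling of J. Initially, with w = 3 sqrt(pi \<open>\<eta>\<close>)/32, one has 9 pi
  \<open>\<eta>\<close>/1024 = w^2 and B3^2 = d/w, so the bounds amount to w <= d and 1 <=
  d.\<close>

lemma B_coeff_ge:
  assumes \<eta>: "0 < \<eta>" and "3 \<le> j"
  shows "1 \<le> B_coeff j \<eta> \<and> 1 \<le> B_coeff j \<eta> * (9 * pi / 1024 * \<eta>) powr (1 / 2 ^ (j - 1))"
  using assms(2)
proof (induction j rule: dec_induct)
  case base
  define w where "w = 3 * sqrt pi / 32 * sqrt \<eta>"
  define d where "d = (delta_tilde \<eta>)\<^sup>2"
  have w0: "0 < w" using \<eta> by (simp add: w_def)
  have t: "9 * pi / 1024 * \<eta> = w\<^sup>2"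
    using \<eta> by (simp add: w_def power_mult_distrib power_divide)
  have d1: "1 \<le> d" and dd: "d * d = d + w * \<eta>"
    using delta_tilde_sq[OF \<eta>] by (auto simp: d_def w_def)
  have Bsq: "(B3 \<eta>)\<^sup>2 = d / w"
    using B3_sq[OF \<eta>] by (simp add: d_def w_def)
  \<comment> \<open>If d < w then w > 1 and d^2 < w^2 <= \<open>\<eta>\<close> <= w
    \<open>\<eta>\<close>, against d^2 = d + w \<open>\<eta>\<close>.\<close>
  have "w \<le> d"
  proof (rule ccontr)
    assume "\<not> w \<le> d"
    then have "d < w" by simp
    have "sqrt pi \<le> 2" using pi_less_4 by (intro real_le_lsqrt) auto
    then have "w * 1 \<le> sqrt \<eta>" using mult_right_mono[of "3 * sqrt pi / 32" 1 "sqrt \<eta>"] \<eta> by (simp add: w_def)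
    then have "w\<^sup>2 \<le> \<eta>" using w0 \<eta> by (metis mult_1_right real_sqrt_pow2 power_mono less_imp_le)
    have "1 < w" using d1 \<open>d < w\<close> by simp
    have "d * d < w * w" using d1 \<open>d < w\<close> by (intro mult_strict_mono) auto
    also have "\<dots> \<le> \<eta>" using \<open>w\<^sup>2 \<le> \<eta>\<close> by (simp add: power2_eq_square)
    also have "\<dots> \<le> w * \<eta>" using \<open>1 < w\<close> \<eta> by simp
    finally show False using dd d1 by simp
  qed
  then have "1\<^sup>2 \<le> (B3 \<eta>)\<^sup>2" using w0 by (simp add: Bsq)
  then have B1: "1 \<le> B3 \<eta>" using power2_le_imp_le[of 1 "B3 \<eta>"] B3_nonneg[OF \<eta>] by simp
  have "(w\<^sup>2) powr (1/4) = sqrt w"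
    using powr_powr[of w 2 "1/4"] w0 by (simp add: powr_half_sqrt)
  moreover have "1\<^sup>2 \<le> (B3 \<eta> * sqrt w)\<^sup>2" using d1 w0 by (simp add: power_mult_distrib Bsq)
  then have "1 \<le> B3 \<eta> * sqrt w"
    by (rule power2_le_imp_le) (use B3_nonneg[OF \<eta>] w0 in auto)
  ultimately show ?case using B1 unfolding coeff_3 t by simp
next
  case (step j)
  define J :: real where "J = 2 ^ (j - 1)"
  define t where "t = 9 * pi / 1024 * \<eta>"
  have B: "1 \<le> B_coeff j \<eta>" "1 \<le> B_coeff j \<eta> * t powr (1 / J)" using step.IH by (auto simp: t_def J_def)
  have t0: "0 < t" using \<eta> by (simp add: t_def)
  have J2: "(2::real) ^ (Suc j - 1) = 2 * J" using step.hyps by (cases j) (auto simp: J_def)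
  have "1 \<le> B_coeff j \<eta> powr (1/2)" using B by (simp add: ge_one_powr_ge_zero)
  moreover have "1 \<le> (B_coeff j \<eta> * t powr (1 / J)) powr (1/2)" using B by (simp add: ge_one_powr_ge_zero)
  then have "1 \<le> B_coeff j \<eta> powr (1/2) * t powr (1 / (2 * J))"
    using B t0 by (simp add: powr_mult powr_powr mult.commute)
  moreover have "B_coeff j \<eta> powr (1/2) * t powr (1 / (2 * J)) \<le> B_coeff (Suc j) \<eta> * t powr (1 / (2 * J))"
    using B_coeff_Suc_ge[of j \<eta>] step.hyps by (intro mult_right_mono) auto
  ultimately show ?case
    using B_coeff_Suc_ge[of j \<eta>] step.hyps unfolding J2 t_def[symmetric] by linarith
qed

section \<open>Induction on the order of the differences\<close>

theorem fdiff_test: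
  assumes "3 \<le> k" "0 < \<eta>" "1 < h" "0 < lam" "0 < N" "fdiff_between k N lam (h * lam) x" "K = 2 ^ (k - 1)"
  shows "norm (\<Sum>n<N. e_fun (x n))
    \<le> A_coeff k \<eta> h * h powr (2 / K) * real N * lam powr (1 / (2 * K - 2))
       + B_coeff k \<eta> * real N powr (1 - 2 / K) * lam powr (- 1 / (2 * K - 2))"
  using assms(1,4-7)
proof (induction k arbitrary: N lam x K rule: dec_induct)
  case base
  have K: "K = 4" using base.prems by simp
  have "norm (\<Sum>n<N. e_fun (x n))
    \<le> A3 \<eta> h * h powr (1/2) * real N * lam powr (1/6) + B3 \<eta> * real N powr (1/2) * lam powr (- 1/6)"
    by (rule third_fdiff_test) (use base.prems assms in auto)
  then show ?case unfolding coeff_3 K by simp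
next
  case (step j)
  define J :: real where "J = 2 ^ (j - 1)"
  have j: "3 \<le> j" by fact
  have J4: "4 \<le> J" unfolding J_def by (rule two_power_ge_4[OF j])
  have K: "K = 2 * J" using step.prems j by (cases j) (auto simp: J_def)
  have J: "J = 4 \<or> 8 \<le> J"
  proof (cases "j = 3")
    case False
    then show ?thesis using j power_increasing[of 3 "j - 1" "2::real"] by (simp add: J_def)
  qed (simp add: J_def)
  have Aj: "0 \<le> A_coeff j \<eta> h" using A_coeff_nonneg assms by simp
  have Bj: "1 \<le> B_coeff j \<eta>" "1 \<le> B_coeff j \<eta> * (9 * pi / 1024 * \<eta>) powr (1 / J)"
    using B_coeff_ge[OF \<open>0 < \<eta>\<close> j] by (auto simp: J_def)
  have "norm (\<Sum>n<N. e_fun (x n))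
    \<le> delta j \<eta> * (h powr (- 1 / J) + 2 powr (19/12) * (J - 1) / sqrt ((2 * J - 1) * (4 * J - 3)) * A_coeff j \<eta> h powr (1/2))
         * h powr (1 / J) * real N * lam powr (1 / (4 * J - 2))
       + delta j \<eta> * (2 powr (3/2) * (J - 1) / sqrt ((2 * J - 3) * (4 * J - 5))) * B_coeff j \<eta> powr (1/2)
         * real N powr (1 - 1 / J) * lam powr (- 1 / (4 * J - 2))"
  proof (rule weyl_step[OF J])
    have "1 / B_coeff j \<eta> \<le> (9 * pi / 1024 * \<eta>) powr (1 / J)"
      using Bj by (simp add: pos_divide_le_eq mult.commute)
    then have "2 / 2337 powr (1 - 2 / J) * (1 / B_coeff j \<eta>) \<le> 2 / 2337 powr (1 - 2 / J) * (9 * pi / 1024 * \<eta>) powr (1 / J)"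
      by (intro mult_left_mono) auto
    then show "2 / (2337 powr (1 - 2 / J) * B_coeff j \<eta>) \<le> (delta j \<eta>)\<^sup>2 - 1"
      by (simp add: delta_sq[OF \<open>0 < \<eta>\<close>] J_def)
  next
    fix m :: nat assume m: "1 \<le> m"
    show "norm (\<Sum>n<N - m. e_fun (x (n + m) - x n))
      \<le> A_coeff j \<eta> h * h powr (2 / J) * real N * (real m * lam) powr (1 / (2 * J - 2))
         + B_coeff j \<eta> * real N powr (1 - 2 / J) * (real m * lam) powr (- 1 / (2 * J - 2))"
    \<comment> \<open>For m >= N the subtraction truncates and the sum is empty; the induction
      hypothesis asks for a positive length.\<close>
    proof (cases "N - m = 0")
      case True
      then show ?thesis using Aj Bj by simp
    next
      case False
      have "norm (\<Sum>n<N - m. e_fun (x (n + m) - x n))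
        \<le> A_coeff j \<eta> h * h powr (2 / J) * real (N - m) * (real m * lam) powr (1 / (2 * J - 2))
         + B_coeff j \<eta> * real (N - m) powr (1 - 2 / J) * (real m * lam) powr (- 1 / (2 * J - 2))"
      proof (rule step.IH)
        show "fdiff_between j (N - m) (real m * lam) (h * (real m * lam)) (\<lambda>n. x (n + m) - x n)"
          using fdiff_between_shift_diff[of j N lam "h * lam" x m] step.prems by (simp add: mult_ac)
      qed (use m step.prems False in \<open>auto simp: J_def\<close>)
      also have "\<dots> \<le> A_coeff j \<eta> h * h powr (2 / J) * real N * (real m * lam) powr (1 / (2 * J - 2))
         + B_coeff j \<eta> * real N powr (1 - 2 / J) * (real m * lam) powr (- 1 / (2 * J - 2))"
        using Aj Bj J4 by (intro add_mono mult_right_mono mult_left_mono powr_mono2) auto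
      finally show ?thesis .
    qed
  qed (use assms step.prems Aj Bj delta_ge_1 in auto)
  moreover have "A_coeff (Suc j) \<eta> h = delta j \<eta> * (h powr (- 1 / J) + 2 powr (19/12) * (J - 1) / sqrt ((2 * J - 1) * (4 * J - 3)) * A_coeff j \<eta> h powr (1/2))"
    "B_coeff (Suc j) \<eta> = delta j \<eta> * (2 powr (3/2) * (J - 1) / sqrt ((2 * J - 3) * (4 * J - 5))) * B_coeff j \<eta> powr (1/2)"
    using j by (simp_all add: Let_def J_def)
  moreover have "2 / K = 1 / J" "2 * K - 2 = 4 * J - 2" by (simp_all add: K)
  ultimately show ?case by (simp only:)
qed

section \<open>From derivatives to forward differences\<close>

text \<open>The induction passes to E = D(. + 1) - D, followed by one mean value step. Two-sided
  derivatives are assumed only in the open interval, since the right end may be a + N, where only a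
  one-sided derivative exists.\<close>

lemma fdiff_eq_derivative:
  fixes D :: "nat \<Rightarrow> real \<Rightarrow> real"
  assumes cont: "\<And>i. i < k \<Longrightarrow> continuous_on {c..c + real k} (D i)"
    and deriv: "\<And>i y. i < k \<Longrightarrow> c < y \<Longrightarrow> y < c + real k \<Longrightarrow> (D i has_real_derivative D (Suc i) y) (at y)"
  shows "\<exists>\<xi>\<in>{c..c + real k}. fdiff k (\<lambda>m. D 0 (c + real m)) 0 = D k \<xi>"
  using assms
proof (induction k arbitrary: D)
  case (Suc k)
  define E where "E i y = D i (y + 1) - D i y" for i y
  have "\<exists>\<xi>\<in>{c..c + real k}. fdiff k (\<lambda>m. E 0 (c + real m)) 0 = E k \<xi>"
  proof (rule Suc.IH)
    fix i assume i: "i < k"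
    have "continuous_on {c..c + real k} (\<lambda>y. D i (y + 1))"
      by (rule continuous_on_compose2[OF Suc.prems(1)[of i]]) (use i in \<open>auto intro!: continuous_intros\<close>)
    moreover have "continuous_on {c..c + real k} (D i)"
      by (rule continuous_on_subset[OF Suc.prems(1)[of i]]) (use i in auto)
    ultimately show "continuous_on {c..c + real k} (E i)"
      unfolding E_def by (intro continuous_intros)
  next
    fix i y assume i: "i < k" and y: "c < y" "y < c + real k"
    have "(D i has_real_derivative D (Suc i) (y + 1)) (at (y + 1))"
      using Suc.prems(2)[of i "y + 1"] i y by simp
    then have "((\<lambda>y. D i (y + 1)) has_real_derivative D (Suc i) (y + 1)) (at y)"
      by (simp add: DERIV_shift)
    moreover have "(D i has_real_derivative D (Suc i) y) (at y)"
      using Suc.prems(2)[of i y] i y by simp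
    ultimately show "(E i has_real_derivative E (Suc i) y) (at y)"
      unfolding E_def by (rule DERIV_diff)
  qed
  then obtain \<xi> where \<xi>: "\<xi> \<in> {c..c + real k}" "fdiff k (\<lambda>m. E 0 (c + real m)) 0 = E k \<xi>" by blast
  have "\<exists>l z. \<xi> < z \<and> z < \<xi> + 1 \<and> DERIV (D k) z :> l \<and> D k (\<xi> + 1) - D k \<xi> = (\<xi> + 1 - \<xi>) * l"
  proof (rule MVT)
    show "continuous_on {\<xi>..\<xi> + 1} (D k)"
      by (rule continuous_on_subset[OF Suc.prems(1)[of k]]) (use \<xi> in auto)
    show "D k differentiable (at y)" if "\<xi> < y" "y < \<xi> + 1" for y
      using Suc.prems(2)[of k y] that \<xi> by (auto simp: real_differentiable_def)
  qed simp
  then obtain l z where z: "\<xi> < z" "z < \<xi> + 1" "DERIV (D k) z :> l" "E k \<xi> = l"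
    by (auto simp: E_def)
  have "l = D (Suc k) z"
    using DERIV_unique[OF z(3) Suc.prems(2)[of k z]] z \<xi> by auto
  moreover have "fdiff (Suc k) (\<lambda>m. D 0 (c + real m)) 0 = fdiff k (\<lambda>m. E 0 (c + real m)) 0"
    using fdiff_shift_diff[of k "\<lambda>m. D 0 (c + real m)" 1 0] by (simp add: E_def add.assoc add.commute[of 1])
  ultimately have "fdiff (Suc k) (\<lambda>m. D 0 (c + real m)) 0 = D (Suc k) z" using \<xi> z by simp
  moreover have "z \<in> {c..c + real (Suc k)}" using z \<xi> by auto
  ultimately show ?case by blast
qed simp

lemma fdiff_shift: "fdiff k (\<lambda>m. x (n + m)) i = fdiff k x (n + i)"
  by (induction k arbitrary: i) auto

lemma fdiff_uminus: "fdiff k (\<lambda>n. - x n) n = - fdiff k x n"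
  by (induction k arbitrary: n) auto

theorem lemma2p5:
  fixes k :: nat and a N :: int and \<eta>\<^sub>3 h lam\<^sub>k K :: real
    and f :: "real \<Rightarrow> real" and D :: "nat \<Rightarrow> real \<Rightarrow> real"
  assumes "k \<ge> 4" and "N > 0" and "\<eta>\<^sub>3 > 0" and "h > 1"
    and "Ck_with_derivs_on k f D {real_of_int a<..real_of_int (a + N)}"
    and "mono_on {real_of_int a<..real_of_int (a + N)} (D k) \<or>
         antimono_on {real_of_int a<..real_of_int (a + N)} (D k)"
    and "0 < lam\<^sub>k"
    and "\<And>x. x \<in> {real_of_int a<..real_of_int (a + N)} \<Longrightarrow>
           lam\<^sub>k \<le> \<bar>D k x\<bar> \<and> \<bar>D k x\<bar> \<le> h * lam\<^sub>k"
    and "K = 2 ^ (k - 1)"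
  shows "S_sum f a N \<le> A_coeff k \<eta>\<^sub>3 h * h powr (2 / K) * real_of_int N * lam\<^sub>k powr (1 / (2 * K - 2))
           + B_coeff k \<eta>\<^sub>3 * real_of_int N powr (1 - 2 / K) * lam\<^sub>k powr (- 1 / (2 * K - 2))"
proof -
  define I where "I = {real_of_int a<..real_of_int (a + N)}"
  define x where "x n = D 0 (of_int a + 1 + real n)" for n
  define M where "M = nat N"
  have M: "0 < M" "int M = N" "real M = of_int N" using assms(2) by (auto simp: M_def)
  note Ck = assms(5)[unfolded Ck_with_derivs_on_def, folded I_def]
  have cont: "continuous_on I (D i)" if "i \<le> k" for i
  proof (cases "i = k")
    case False
    then show ?thesis using Ck that by (intro DERIV_continuous_on[of I "D i" "D (Suc i)"]) auto
  qed (use Ck in simp)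
  have deriv: "(D i has_real_derivative D (Suc i) y) (at y)" if "i < k" "of_int a < y" "y < of_int (a + N)" for i y
  proof -
    have "(D i has_real_derivative D (Suc i) y) (at y within {of_int a<..<of_int (a + N)})"
      by (rule DERIV_subset[of _ _ _ I]) (use Ck that in \<open>auto simp: I_def\<close>)
    moreover have "at y within {of_int a<..<of_int (a + N)} = at y"
      using that by (intro at_within_open) auto
    ultimately show ?thesis by (simp only:)
  qed
  have mean: "\<exists>\<xi>\<in>I. fdiff k x n = D k \<xi>" if "n + k < M" for n
  proof -
    define c where "c = of_int a + 1 + real n"
    have "real n + real k + 1 \<le> of_int N" using that M by linarith
    then have sub: "of_int a < c" "c + real k \<le> of_int (a + N)" by (auto simp: c_def)
    then have cI: "{c..c + real k} \<subseteq> I" by (auto simp: I_def)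
    have "\<exists>\<xi>\<in>{c..c + real k}. fdiff k (\<lambda>m. D 0 (c + real m)) 0 = D k \<xi>"
    proof (rule fdiff_eq_derivative)
      show "continuous_on {c..c + real k} (D i)" if "i < k" for i
        using continuous_on_subset[OF cont cI] that by simp
      show "(D i has_real_derivative D (Suc i) y) (at y)" if "i < k" "c < y" "y < c + real k" for i y
        using that sub by (intro deriv) auto
    qed
    moreover have "fdiff k x n = fdiff k (\<lambda>m. D 0 (c + real m)) 0"
      using fdiff_shift[of k x n 0] by (simp add: x_def c_def add.assoc)
    ultimately show ?thesis using cI by auto
  qed
  \<comment> \<open>|D k| >= lambda_k > 0 excludes zeros, and a continuous function without zeros on
    an interval has constant sign.\<close>
  have sign: "(\<forall>y\<in>I. 0 < D k y) \<or> (\<forall>y\<in>I. D k y < 0)"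
  proof (rule ccontr)
    have nz: "D k y \<noteq> 0" if "y \<in> I" for y
      using assms(8)[of y] assms(7) that by (auto simp: I_def)
    assume "\<not> ?thesis"
    then obtain y z where yz: "y \<in> I" "z \<in> I" "D k y < 0" "0 < D k z"
      using nz by (metis linorder_neqE_linordered_idom)
    have "connected (D k ` I)"
      using cont[of k] by (intro connected_continuous_image) (auto simp: I_def)
    then have "{D k y..D k z} \<subseteq> D k ` I" using yz by (intro connected_contains_Icc) auto
    then have "0 \<in> D k ` I" using yz by auto
    then show False using nz by auto
  qed
  have "norm (\<Sum>n<M. e_fun (x n))
    \<le> A_coeff k \<eta>\<^sub>3 h * h powr (2 / K) * real M * lam\<^sub>k powr (1 / (2 * K - 2))
       + B_coeff k \<eta>\<^sub>3 * real M powr (1 - 2 / K) * lam\<^sub>k powr (- 1 / (2 * K - 2))" (is "_ \<le> ?R")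
    using sign
  proof
    assume pos: "\<forall>y\<in>I. 0 < D k y"
    have "fdiff_between k M lam\<^sub>k (h * lam\<^sub>k) x"
      unfolding fdiff_between_def
    proof (intro allI impI)
      fix n assume "n + k < M"
      then obtain \<xi> where "\<xi> \<in> I" "fdiff k x n = D k \<xi>" using mean by blast
      then show "lam\<^sub>k \<le> fdiff k x n \<and> fdiff k x n \<le> h * lam\<^sub>k"
        using pos assms(8)[of \<xi>] by (force simp: I_def)
    qed
    then show ?thesis using assms M by (intro fdiff_test) auto
  next
    assume neg: "\<forall>y\<in>I. D k y < 0"
    have "fdiff_between k M lam\<^sub>k (h * lam\<^sub>k) (\<lambda>n. - x n)"
      unfolding fdiff_between_def fdiff_uminus
    proof (intro allI impI)
      fix n assume "n + k < M"
      then obtain \<xi> where "\<xi> \<in> I" "fdiff k x n = D k \<xi>" using mean by blast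
      then show "lam\<^sub>k \<le> - fdiff k x n \<and> - fdiff k x n \<le> h * lam\<^sub>k"
        using neg assms(8)[of \<xi>] by (force simp: I_def)
    qed
    then have "norm (\<Sum>n<M. e_fun (- x n)) \<le> ?R" using assms M by (intro fdiff_test) auto
    moreover have "(\<Sum>n<M. e_fun (- x n)) = cnj (\<Sum>n<M. e_fun (x n))" by (simp add: cnj_e_fun)
    ultimately show ?thesis by (simp only: complex_mod_cnj)
  qed
  moreover have "(\<Sum>n\<in>{a<..a + N}. e_fun (f (of_int n))) = (\<Sum>n<M. e_fun (x n))"
  proof (rule sum.reindex_bij_witness[of _ "\<lambda>n. a + 1 + int n" "\<lambda>n. nat (n - a - 1)"])
    fix n assume n: "n \<in> {a<..a + N}"
    then have "real_of_int n \<in> I" by (auto simp: I_def)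
    moreover have "of_int a + 1 + real (nat (n - a - 1)) = of_int n" using n by simp
    ultimately show "e_fun (x (nat (n - a - 1))) = e_fun (f (of_int n))"
      using Ck by (simp add: x_def)
  qed (use M in auto)
  ultimately show ?thesis by (simp add: S_sum_def M)
qed

end
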